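(* There is an absolute constant $C>0$ such that the following holds. Consider the Sherrington-Kirkpatrick model with $N$ sites at inverse temperature $\beta\ge0$. Take any $t\ge0$, and suppose the couplings are continuously perturbed up to time $t$. Let $\sigma^1$ be chosen from the original Gibbs measure and $\sigma^2$ from the perturbed measure. Then for any positive integer $k$, $$\mathbb{E}(R_{1,2}^{2k})\le(Ck)^kN^{-k\min\{1,\;t/(C\log(1+C\beta))\}},$$ where the expectation is taken over all randomness. (For $\beta=0$ the minimum is interpreted as $1$.)
   Context: The Sherrington-Kirkpatrick (S-K) model: $(g_{ij})_{1\le i,j\le N}$ are i.i.d. standard Gaussian random variables (the couplings), the Hamiltonian is $H_N(\sigma)=-\frac1{\sqrt{2N}}\sum_{1\le i,j\le N}g_{ij}\sigma_i\sigma_j$ for $\sigma\in\{-1,1\}^N$, and the Gibbs measure at inverse temperature $\beta$ gives mass proportional to $e^{-\beta H_N(\sigma)}$ to $\sigma\in\{-1,1\}^N$. Continuous perturbation up to time $t$ means replacing each $g_{ij}$ by $e^{-t}g_{ij}+\sqrt{1-e^{-2t}}\,g'_{ij}$, where $(g'_{ij})$ is an independent copy of $(g_{ij})$; the perturbed Gibbs measure is the Gibbs measure at the same $\beta$ with these new couplings. Given $(g_{ij})$ and $(g'_{ij})$, $\sigma^1$ and $\sigma^2$ are drawn independently. The overlap is $R_{1,2}:=\frac1N\sum_{i=1}^N\sigma^1_i\sigma^2_i$. *)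

theory Defs
  imports "HOL-Probability.Probability"
begin

definition spin_configs :: "nat \<Rightarrow> (nat \<Rightarrow> real) set" where
  "spin_configs N = {1..N} \<rightarrow>\<^sub>E {-1, 1}"

definition hamiltonian :: "nat \<Rightarrow> (nat \<times> nat \<Rightarrow> real) \<Rightarrow> (nat \<Rightarrow> real) \<Rightarrow> real" where
  "hamiltonian N g \<sigma> =
     - (1 / sqrt (2 * real N)) * (\<Sum>i\<in>{1..N}. \<Sum>j\<in>{1..N}. g (i, j) * \<sigma> i * \<sigma> j)"

definition partition_function :: "nat \<Rightarrow> real \<Rightarrow> (nat \<times> nat \<Rightarrow> real) \<Rightarrow> real" where
  "partition_function N \<beta> g = (\<Sum>\<sigma>\<in>spin_configs N. exp (- \<beta> * hamiltonian N g \<sigma>))"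

definition gibbs_weight :: "nat \<Rightarrow> real \<Rightarrow> (nat \<times> nat \<Rightarrow> real) \<Rightarrow> (nat \<Rightarrow> real) \<Rightarrow> real" where
  "gibbs_weight N \<beta> g \<sigma> =
     (if \<sigma> \<in> spin_configs N
      then exp (- \<beta> * hamiltonian N g \<sigma>) / partition_function N \<beta> g else 0)"

text \<open>That the weights sum to 1, so that \<open>embed_pmf\<close> is meaningful here, is shown in
  \<open>pmf_gibbs\<close> below.\<close>

definition gibbs :: "nat \<Rightarrow> real \<Rightarrow> (nat \<times> nat \<Rightarrow> real) \<Rightarrow> (nat \<Rightarrow> real) pmf" where
  "gibbs N \<beta> g = embed_pmf (gibbs_weight N \<beta> g)"

definition gaussian_couplings :: "nat \<Rightarrow> (nat \<times> nat \<Rightarrow> real) measure" where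
  "gaussian_couplings N =
     PiM ({1..N} \<times> {1..N}) (\<lambda>_. density lborel (\<lambda>x. ennreal (std_normal_density x)))"

definition perturb ::
  "real \<Rightarrow> (nat \<times> nat \<Rightarrow> real) \<Rightarrow> (nat \<times> nat \<Rightarrow> real) \<Rightarrow> nat \<times> nat \<Rightarrow> real" where
  "perturb t g g' = (\<lambda>e. exp (- t) * g e + sqrt (1 - exp (- 2 * t)) * g' e)"

text \<open>The law of the pair of replicas with the disorder averaged out: draw independent
  \<open>g\<close> and \<open>g'\<close>, and then, conditionally on them, independent configurations from the Gibbs
  measures with couplings \<open>g\<close> and \<open>perturb t g g'\<close>.
  The kernel is measurable, as \<open>bind\<close> requires: see \<open>measurable_replica_kernel\<close> below.\<close>

definition replica_law ::
  "nat \<Rightarrow> real \<Rightarrow> real \<Rightarrow> ((nat \<Rightarrow> real) \<times> (nat \<Rightarrow> real)) measure" where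
  "replica_law N \<beta> t =
     bind (gaussian_couplings N \<Otimes>\<^sub>M gaussian_couplings N)
       (\<lambda>(g, g'). measure_pmf (pair_pmf (gibbs N \<beta> g) (gibbs N \<beta> (perturb t g g'))))"

definition overlap :: "nat \<Rightarrow> (nat \<Rightarrow> real) \<Rightarrow> (nat \<Rightarrow> real) \<Rightarrow> real" where
  "overlap N \<sigma>1 \<sigma>2 = (\<Sum>i\<in>{1..N}. \<sigma>1 i * \<sigma>2 i) / real N"

lemma finite_spin_configs [simp]: "finite (spin_configs N)"
  by (simp add: spin_configs_def finite_PiE)

lemma spin_configs_nonempty [simp]: "spin_configs N \<noteq> {}"
  by (simp add: spin_configs_def PiE_eq_empty_iff)

lemma partition_function_pos: "partition_function N \<beta> g > 0"
  unfolding partition_function_def by (intro sum_pos) auto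

lemma gibbs_weight_nonneg: "gibbs_weight N \<beta> g \<sigma> \<ge> 0"
  using partition_function_pos[of N \<beta> g] by (simp add: gibbs_weight_def)

lemma pmf_gibbs: "pmf (gibbs N \<beta> g) \<sigma> = gibbs_weight N \<beta> g \<sigma>"
proof -
  have "(\<Sum>\<sigma>\<in>spin_configs N. gibbs_weight N \<beta> g \<sigma>) = 1"
    using partition_function_pos[of N \<beta> g]
    by (simp add: gibbs_weight_def partition_function_def flip: sum_divide_distrib)
  moreover have "(\<integral>\<^sup>+\<sigma>. ennreal (gibbs_weight N \<beta> g \<sigma>) \<partial>count_space UNIV) =
      (\<Sum>\<sigma>\<in>spin_configs N. ennreal (gibbs_weight N \<beta> g \<sigma>))"
    by (rule nn_integral_count_space') (auto simp: gibbs_weight_def)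
  ultimately have "(\<integral>\<^sup>+\<sigma>. ennreal (gibbs_weight N \<beta> g \<sigma>) \<partial>count_space UNIV) = 1"
    by (simp add: gibbs_weight_nonneg)
  then show ?thesis
    unfolding gibbs_def by (intro pmf_embed_pmf) (auto simp: gibbs_weight_nonneg)
qed

lemma set_pmf_gibbs: "set_pmf (gibbs N \<beta> g) = spin_configs N"
  using partition_function_pos[of N \<beta> g]
  by (auto simp: set_pmf_eq pmf_gibbs gibbs_weight_def)

lemma sets_gaussian_couplings [measurable_cong]:
  "sets (gaussian_couplings N) = sets (PiM ({1..N} \<times> {1..N}) (\<lambda>_. borel))"
  unfolding gaussian_couplings_def by (intro sets_PiM_cong) auto

lemma prob_space_gaussian_couplings: "prob_space (gaussian_couplings N)"
  unfolding gaussian_couplings_def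
  by (intro prob_space_PiM prob_space_normal_density) simp

lemma borel_measurable_gibbs_weight:
  assumes "\<And>e. e \<in> {1..N} \<times> {1..N} \<Longrightarrow> (\<lambda>x. f x e) \<in> borel_measurable M"
  shows "(\<lambda>x. gibbs_weight N \<beta> (f x) \<sigma>) \<in> borel_measurable M"
proof -
  have "(\<lambda>x. hamiltonian N (f x) \<tau>) \<in> borel_measurable M" for \<tau>
    unfolding hamiltonian_def using assms
    by (intro borel_measurable_times borel_measurable_sum borel_measurable_const) auto
  then show ?thesis
    unfolding gibbs_weight_def partition_function_def by (cases "\<sigma> \<in> spin_configs N") auto
qed

lemma measurable_replica_kernel:
  "(\<lambda>(g, g'). measure_pmf (pair_pmf (gibbs N \<beta> g) (gibbs N \<beta> (perturb t g g'))))
     \<in> measurable (gaussian_couplings N \<Otimes>\<^sub>M gaussian_couplings N)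
         (prob_algebra (count_space UNIV))"
  (is "?K \<in> measurable ?M _")
proof (rule measurable_prob_algebraI)
  show "prob_space (?K x)" for x
    by (auto simp: case_prod_beta intro: prob_space_measure_pmf)
  have comp: "(\<lambda>x. fst x e) \<in> borel_measurable ?M" "(\<lambda>x. snd x e) \<in> borel_measurable ?M"
    if "e \<in> {1..N} \<times> {1..N}" for e
    using that by measurable
  show "?K \<in> measurable ?M (subprob_algebra (count_space UNIV))"
  proof (rule measurable_subprob_algebra)
    fix A :: "((nat \<Rightarrow> real) \<times> (nat \<Rightarrow> real)) set"
    let ?B = "A \<inter> spin_configs N \<times> spin_configs N"
    have "emeasure (?K x) A = (\<Sum>p\<in>?B. ennreal (gibbs_weight N \<beta> (fst x) (fst p) *
        gibbs_weight N \<beta> (perturb t (fst x) (snd x)) (snd p)))" for x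
    proof -
      have "emeasure (?K x) A = emeasure (?K x) ?B"
        unfolding case_prod_beta
        by (rule emeasure_eq_AE) (auto simp: AE_measure_pmf_iff set_pmf_gibbs)
      also have "\<dots> = (\<Sum>p\<in>?B. ennreal (gibbs_weight N \<beta> (fst x) (fst p) *
          gibbs_weight N \<beta> (perturb t (fst x) (snd x)) (snd p)))"
        unfolding case_prod_beta
        by (subst emeasure_measure_pmf_finite)
          (auto simp: pmf_pair pmf_gibbs gibbs_weight_nonneg simp flip: sum_ennreal intro!: sum.cong)
      finally show ?thesis .
    qed
    moreover have "(\<lambda>x. gibbs_weight N \<beta> (fst x) \<sigma>) \<in> borel_measurable ?M"
      and "(\<lambda>x. gibbs_weight N \<beta> (perturb t (fst x) (snd x)) \<sigma>) \<in> borel_measurable ?M" for \<sigma>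
      unfolding perturb_def
      by (intro borel_measurable_gibbs_weight borel_measurable_add borel_measurable_times
            borel_measurable_const comp; assumption)+
    ultimately show "(\<lambda>x. emeasure (?K x) A) \<in> borel_measurable ?M"
      by simp
  qed (auto simp: case_prod_beta intro!: prob_space_imp_subprob_space prob_space_measure_pmf)
qed

lemma space_gaussian_couplings_prob_algebra:
  "gaussian_couplings N \<Otimes>\<^sub>M gaussian_couplings N
     \<in> space (prob_algebra (gaussian_couplings N \<Otimes>\<^sub>M gaussian_couplings N))"
  using prob_space_gaussian_couplings[of N]
  by (simp add: space_prob_algebra prob_space_pair)

lemma prob_space_replica_law: "prob_space (replica_law N \<beta> t)"
  unfolding replica_law_def
  by (rule prob_space_bind'[OF space_gaussian_couplings_prob_algebra measurable_replica_kernel])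

lemma sets_replica_law: "sets (replica_law N \<beta> t) = UNIV"
  using sets_bind'[OF space_gaussian_couplings_prob_algebra measurable_replica_kernel]
  by (simp add: replica_law_def)

end

(* Chaos is measured by phi_k(rho) = E R^(2k) for couplings of correlation rho = exp (-t).  Expanding
   R^(2k) into spin monomials turns phi_k(rho) into an average of terms E f(g) f(g'), and splitting
   the common noise symmetrically writes each of them as E (E (f | common part))^2.  Hence, by
   Jensen, phi_k(rho)^2 \<le> phi_k(rho^2): a bound at time 2 t gives its square root at time t.

   Moving an infinitesimal amount of private noise into the common part costs a Gaussian variance,
   which a Poincare inequality bounds by the gradient of a Gibbs average; this gives
   phi_k' \<le> 2 beta^2 N phi_(k+1).  The hierarchy starts at rho = 0 from independent disorder, where
   gauge symmetry reduces R to a normalised sum of independent signs, and comparison with its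
   explicit supersolution gives phi_k(rho) \<le> (C k / N)^k as long as beta^2 rho is small, that is for
   times beyond a multiple of log (1 + C beta).  Doubling carries the bound to shorter times. *)
theory Submission
  imports Defs
begin

section \<open>Gaussian vectors and Gaussian convolution\<close>

text \<open>The hierarchy is not closed: moment k is controlled through moment k+1, so all orders
  are carried at once and every error must be uniform in k. Normalising the monomial expansion by
  N^(2k) achieves this, because each monomial average lies in [-1,1]. No derivative in \<rho> is
  ever taken. Moving a finite variance b costs an error of order b^(3/2), so n moves of size
  \<rho>/n accumulate an error of order n^(-1/2), which vanishes in the limit. Even powers make the
  gradient bound work: summing over all couplings produces one more factor (N R)^2, and the
  disconnected part of the Gibbs covariance is absorbed by Chebyshev's association inequality, since
  R^(2k) and R^2 increase together. Constants: independent signs give 2 6^k k! / N^k, an initial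
  value whose supersolution blows up at distance N/6. The condition \<beta>^2 \<rho> \<le> 1/24
  spends at most half of that distance, which leaves 4 12^k k! / N^k, at most (48 k)^k / N^k. The
  time 2 ln (1 + 5 \<beta>) yields \<beta>^2 \<rho> \<le> 1/25.\<close>

lemma gaussian_product_reflection:
  fixes c s x y :: real
  assumes "c\<^sup>2 + s\<^sup>2 = 1"
  shows "std_normal_density (c * x + s * y) * std_normal_density (s * x - c * y) =
    std_normal_density x * std_normal_density y"
proof -
  have "(c * x + s * y)\<^sup>2 + (s * x - c * y)\<^sup>2 = (c\<^sup>2 + s\<^sup>2) * (x\<^sup>2 + y\<^sup>2)"
    by algebra
  then have "(c * x + s * y)\<^sup>2 + (s * x - c * y)\<^sup>2 = x\<^sup>2 + y\<^sup>2"
    using assms by simp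
  then have "- (c * x + s * y)\<^sup>2 / 2 + - (s * x - c * y)\<^sup>2 / 2 = - x\<^sup>2 / 2 + - y\<^sup>2 / 2"
    by (simp add: field_simps)
  then have "exp (- (c * x + s * y)\<^sup>2 / 2) * exp (- (s * x - c * y)\<^sup>2 / 2) =
      exp (- x\<^sup>2 / 2) * exp (- y\<^sup>2 / 2)"
    by (simp only: exp_add[symmetric])
  then show ?thesis
    unfolding std_normal_density_def by simp
qed

text \<open>A plane reflection is carried out by two successive affine substitutions in one variable.\<close>

lemma nn_integral_gaussian_reflection:
  fixes c s :: real and F :: "real \<Rightarrow> real \<Rightarrow> ennreal"
  assumes cs: "c\<^sup>2 + s\<^sup>2 = 1" and s: "s > 0"
    and F[measurable]: "(\<lambda>(x, y). F x y) \<in> borel_measurable (borel \<Otimes>\<^sub>M borel)"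
  shows "(\<integral>\<^sup>+x. \<integral>\<^sup>+y. F (c * x + s * y) (s * x - c * y) \<partial>std_normal_distribution \<partial>std_normal_distribution) =
    (\<integral>\<^sup>+x. \<integral>\<^sup>+y. F x y \<partial>std_normal_distribution \<partial>std_normal_distribution)"
proof -
  have [measurable]: "std_normal_density \<in> borel_measurable borel" by simp
  have cc: "c * c = 1 - s * s" using cs by (simp add: power2_eq_square)
  let ?n = "\<lambda>x. ennreal (std_normal_density x)"
  let ?G = "\<lambda>x y. ?n x * (?n y * F (c * x + s * y) (s * x - c * y))"
  have "(\<integral>\<^sup>+x. \<integral>\<^sup>+y. F (c * x + s * y) (s * x - c * y) \<partial>std_normal_distribution \<partial>std_normal_distribution) =
     (\<integral>\<^sup>+x. \<integral>\<^sup>+y. ?G x y \<partial>lborel \<partial>lborel)"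
    by (simp add: nn_integral_density nn_integral_cmult)
  also have "\<dots> = (\<integral>\<^sup>+x. (1 / s) * (\<integral>\<^sup>+u. ?G x (- (c * x / s) + (1 / s) * u) \<partial>lborel) \<partial>lborel)"
  proof (rule nn_integral_cong)
    fix x :: real
    show "(\<integral>\<^sup>+y. ?G x y \<partial>lborel) = (1 / s) * (\<integral>\<^sup>+u. ?G x (- (c * x / s) + (1 / s) * u) \<partial>lborel)"
      using s by (subst nn_integral_real_affine[where c="1/s" and t="- (c * x / s)"]) auto
  qed
  also have "\<dots> = (1 / s) * (\<integral>\<^sup>+u. \<integral>\<^sup>+x. ?G x (- (c * x / s) + (1 / s) * u) \<partial>lborel \<partial>lborel)"
    by (subst nn_integral_cmult, measurable)
       (subst lborel_pair.Fubini', auto)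
  also have "\<dots> = (1 / s) * (\<integral>\<^sup>+u. s * (\<integral>\<^sup>+v. ?G (c * u + s * v) (- (c * (c * u + s * v) / s) + (1 / s) * u) \<partial>lborel) \<partial>lborel)"
  proof (intro arg_cong2[where f="(*)"] nn_integral_cong refl)
    fix u :: real
    show "(\<integral>\<^sup>+x. ?G x (- (c * x / s) + (1 / s) * u) \<partial>lborel) =
        s * (\<integral>\<^sup>+v. ?G (c * u + s * v) (- (c * (c * u + s * v) / s) + (1 / s) * u) \<partial>lborel)"
      using s by (subst nn_integral_real_affine[where c=s and t="c * u"]) auto
  qed
  also have "\<dots> = (1 / s) * (s * (\<integral>\<^sup>+u. (\<integral>\<^sup>+v. ?G (c * u + s * v) (- (c * (c * u + s * v) / s) + (1 / s) * u) \<partial>lborel) \<partial>lborel))"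
    by (subst nn_integral_cmult) auto
  also have "\<dots> = (\<integral>\<^sup>+u. (\<integral>\<^sup>+v. ?G (c * u + s * v) (- (c * (c * u + s * v) / s) + (1 / s) * u) \<partial>lborel) \<partial>lborel)"
    using s by (simp flip: mult.assoc ennreal_mult)
  also have "\<dots> = (\<integral>\<^sup>+u. \<integral>\<^sup>+v. ?n u * (?n v * F u v) \<partial>lborel \<partial>lborel)"
  proof (intro nn_integral_cong)
    fix u v :: real
    have "c * (c * u + s * v) = (c * c) * u + s * (c * v)" by algebra
    also have "\<dots> = u - s * (s * u - c * v)" unfolding cc by algebra
    finally have eq: "c * (c * u + s * v) = u - s * (s * u - c * v)" .
    have y: "- (c * (c * u + s * v) / s) + (1 / s) * u = s * u - c * v"
      unfolding eq using s by (simp add: diff_divide_distrib)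
    have "s * (c * u + s * v) - c * (s * u - c * v) = (s * s + c * c) * v"
      by algebra
    then have "c * (c * u + s * v) + s * (s * u - c * v) = u" "s * (c * u + s * v) - c * (s * u - c * v) = v"
      by (simp_all add: cc eq)
    then show "?G (c * u + s * v) (- (c * (c * u + s * v) / s) + (1 / s) * u) = ?n u * (?n v * F u v)"
      unfolding y using gaussian_product_reflection[OF cs, of u v]
      by (simp flip: mult.assoc ennreal_mult)
  qed
  also have "\<dots> = (\<integral>\<^sup>+x. \<integral>\<^sup>+y. F x y \<partial>std_normal_distribution \<partial>std_normal_distribution)"
    by (simp add: nn_integral_density nn_integral_cmult)
  finally show ?thesis .
qed

section \<open>Standard Gaussian vectors and their invariance under reflections\<close>

definition gauss :: "'i set \<Rightarrow> ('i \<Rightarrow> real) measure" where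
  "gauss E = PiM E (\<lambda>_. std_normal_distribution)"

lemma sets_gauss [measurable_cong]: "sets (gauss E) = sets (PiM E (\<lambda>_. borel))"
  unfolding gauss_def by (intro sets_PiM_cong) auto

lemma space_gauss: "space (gauss E) = E \<rightarrow>\<^sub>E UNIV"
  by (simp add: gauss_def space_PiM)

lemma prob_space_gauss: "prob_space (gauss E)"
  unfolding gauss_def by (intro prob_space_PiM prob_space_normal_density) simp

lemma prob_space_std_normal: "prob_space std_normal_distribution"
  by (rule prob_space_normal_density) simp

interpretation gauss: prob_space "gauss E" for E
  by (rule prob_space_gauss)

interpretation gauss2: pair_prob_space "gauss E" "gauss E'" for E E' ..

lemma product_sigma_finite_std_normal: "product_sigma_finite (\<lambda>_. std_normal_distribution)"
  by (intro product_sigma_finite.intro prob_space_imp_sigma_finite prob_space_std_normal)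

lemma nn_integral_gauss_insert:
  assumes "finite E" "e \<notin> E" "f \<in> borel_measurable (PiM (insert e E) (\<lambda>_. borel))"
  shows "(\<integral>\<^sup>+x. f x \<partial>gauss (insert e E)) = (\<integral>\<^sup>+u. \<integral>\<^sup>+x. f (x(e := u)) \<partial>gauss E \<partial>std_normal_distribution)"
  unfolding gauss_def
  by (rule product_sigma_finite.product_nn_integral_insert_rev[OF product_sigma_finite_std_normal assms(1,2)])
     (use assms(3) in \<open>simp add: measurable_cong_sets[OF sets_gauss[unfolded gauss_def] refl]\<close>)

lemma measurable_upd_insert:
  assumes "f \<in> measurable M (PiM E (\<lambda>_. borel))" "h \<in> borel_measurable M"
  shows "(\<lambda>x. (f x)(e := h x)) \<in> measurable M (PiM (insert e E) (\<lambda>_. borel))"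
  by (rule measurable_fun_upd[OF _ assms]) auto

text \<open>Fubini brings the new coordinate of both vectors outermost. In the induction on the
  index set, the hypothesis then acts on the inner integrals and the planar case on the outer
  ones.\<close>

lemma nn_integral_gauss_pair_insert:
  assumes E: "finite E" "e \<notin> E"
    and F: "(\<lambda>(x, y). F x y) \<in> borel_measurable (PiM (insert e E) (\<lambda>_. borel) \<Otimes>\<^sub>M PiM (insert e E) (\<lambda>_. borel))"
  shows "(\<integral>\<^sup>+x. \<integral>\<^sup>+y. F x y \<partial>gauss (insert e E) \<partial>gauss (insert e E)) =
    (\<integral>\<^sup>+u. \<integral>\<^sup>+v. \<integral>\<^sup>+x. \<integral>\<^sup>+y. F (x(e := u)) (y(e := v)) \<partial>gauss E \<partial>gauss E
      \<partial>std_normal_distribution \<partial>std_normal_distribution)"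
proof -
  note [measurable] = F measurable_upd_insert
  interpret \<gamma>: prob_space std_normal_distribution by (rule prob_space_std_normal)
  interpret P: pair_sigma_finite "gauss E" std_normal_distribution by standard
  have 1: "(\<integral>\<^sup>+y. F x y \<partial>gauss (insert e E)) =
      (\<integral>\<^sup>+v. \<integral>\<^sup>+y. F x (y(e := v)) \<partial>gauss E \<partial>std_normal_distribution)"
    if x: "x \<in> space (gauss (insert e E))" for x
  proof (rule nn_integral_gauss_insert[OF E])
    have [measurable]: "x \<in> space (PiM (insert e E) (\<lambda>_. borel))"
      using x by (simp add: space_gauss space_PiM)
    show "F x \<in> borel_measurable (PiM (insert e E) (\<lambda>_. borel))"
      by measurable
  qed
  have "(\<integral>\<^sup>+x. \<integral>\<^sup>+y. F x y \<partial>gauss (insert e E) \<partial>gauss (insert e E)) =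
      (\<integral>\<^sup>+x. \<integral>\<^sup>+v. \<integral>\<^sup>+y. F x (y(e := v)) \<partial>gauss E \<partial>std_normal_distribution \<partial>gauss (insert e E))"
    by (intro nn_integral_cong 1)
  also have "\<dots> = (\<integral>\<^sup>+u. \<integral>\<^sup>+x. \<integral>\<^sup>+v. \<integral>\<^sup>+y. F (x(e := u)) (y(e := v)) \<partial>gauss E
      \<partial>std_normal_distribution \<partial>gauss E \<partial>std_normal_distribution)"
    by (rule nn_integral_gauss_insert[OF E]) measurable
  also have "\<dots> = (\<integral>\<^sup>+u. \<integral>\<^sup>+v. \<integral>\<^sup>+x. \<integral>\<^sup>+y. F (x(e := u)) (y(e := v)) \<partial>gauss E \<partial>gauss E
      \<partial>std_normal_distribution \<partial>std_normal_distribution)"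
    by (intro nn_integral_cong P.Fubini'[symmetric]) measurable
  finally show ?thesis .
qed

text \<open>The same planar reflection acts on each pair of coordinates separately, hence induction
  on \<open>E\<close>. A reflection is preferred to a rotation because it is its own inverse, so the
  old variables are recovered from the new ones by the same formula.\<close>

lemma nn_integral_gauss_reflection:
  fixes c s :: real and F :: "('i \<Rightarrow> real) \<Rightarrow> ('i \<Rightarrow> real) \<Rightarrow> ennreal"
  assumes "finite E" and cs: "c\<^sup>2 + s\<^sup>2 = 1" and s: "s > 0"
    and "(\<lambda>(x, y). F x y) \<in> borel_measurable (PiM E (\<lambda>_. borel) \<Otimes>\<^sub>M PiM E (\<lambda>_. borel))"
  shows "(\<integral>\<^sup>+x. \<integral>\<^sup>+y. F (\<lambda>e\<in>E. c * x e + s * y e) (\<lambda>e\<in>E. s * x e - c * y e) \<partial>gauss E \<partial>gauss E) =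
    (\<integral>\<^sup>+x. \<integral>\<^sup>+y. F x y \<partial>gauss E \<partial>gauss E)"
  using assms(1,4)
proof (induction E arbitrary: F)
  case empty
  have "x = (\<lambda>_. undefined)" if "x \<in> space (gauss {})" for x :: "'i \<Rightarrow> real"
    using that by (simp add: space_gauss)
  then have emp: "F x y = F (\<lambda>_. undefined) (\<lambda>_. undefined)"
    if "x \<in> space (gauss {})" "y \<in> space (gauss {})" for x y
    using that by blast
  have "(\<integral>\<^sup>+x. \<integral>\<^sup>+y. F x y \<partial>gauss {} \<partial>gauss {}) = (\<integral>\<^sup>+x. \<integral>\<^sup>+y. F (\<lambda>_. undefined) (\<lambda>_. undefined) \<partial>gauss ({} :: 'i set) \<partial>gauss ({} :: 'i set))"
    by (rule nn_integral_cong, rule nn_integral_cong, rule emp)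
  then show ?case by (simp add: restrict_def)
next
  case (insert e E)
  note [measurable] = insert.prems measurable_upd_insert
  let ?T = "\<lambda>x y. \<lambda>e\<in>E. c * x e + s * y e" and ?S = "\<lambda>x y. \<lambda>e\<in>E. s * x e - c * y e"
  let ?\<gamma> = "std_normal_distribution"
  have upd: "(\<lambda>i\<in>insert e E. c * (x(e := u)) i + s * (y(e := v)) i) = (?T x y)(e := c * u + s * v)"
    "(\<lambda>i\<in>insert e E. s * (x(e := u)) i - c * (y(e := v)) i) = (?S x y)(e := s * u - c * v)" for x y u v
    using insert.hyps by (auto simp: fun_eq_iff restrict_def)
  have "(\<integral>\<^sup>+x. \<integral>\<^sup>+y. F (\<lambda>i\<in>insert e E. c * x i + s * y i) (\<lambda>i\<in>insert e E. s * x i - c * y i)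
        \<partial>gauss (insert e E) \<partial>gauss (insert e E)) =
      (\<integral>\<^sup>+u. \<integral>\<^sup>+v. \<integral>\<^sup>+x. \<integral>\<^sup>+y. F ((?T x y)(e := c * u + s * v)) ((?S x y)(e := s * u - c * v))
        \<partial>gauss E \<partial>gauss E \<partial>?\<gamma> \<partial>?\<gamma>)"
    by (subst nn_integral_gauss_pair_insert[OF insert.hyps]) (measurable, simp only: upd)
  also have "\<dots> = (\<integral>\<^sup>+u. \<integral>\<^sup>+v. \<integral>\<^sup>+x. \<integral>\<^sup>+y. F (x(e := c * u + s * v)) (y(e := s * u - c * v))
        \<partial>gauss E \<partial>gauss E \<partial>?\<gamma> \<partial>?\<gamma>)"
    by (intro nn_integral_cong insert.IH) measurable
  also have "\<dots> = (\<integral>\<^sup>+u. \<integral>\<^sup>+v. \<integral>\<^sup>+x. \<integral>\<^sup>+y. F (x(e := u)) (y(e := v)) \<partial>gauss E \<partial>gauss E \<partial>?\<gamma> \<partial>?\<gamma>)"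
    by (rule nn_integral_gaussian_reflection[OF cs s]) measurable
  also have "\<dots> = (\<integral>\<^sup>+x. \<integral>\<^sup>+y. F x y \<partial>gauss (insert e E) \<partial>gauss (insert e E))"
    by (rule nn_integral_gauss_pair_insert[OF insert.hyps, symmetric]) measurable
  finally show ?case .
qed

lemma distr_gauss_reflection:
  assumes "finite E" "c\<^sup>2 + s\<^sup>2 = 1" "s > 0"
  shows "distr (gauss E \<Otimes>\<^sub>M gauss E) (gauss E \<Otimes>\<^sub>M gauss E)
      (\<lambda>(x, y). (\<lambda>e\<in>E. c * x e + s * y e, \<lambda>e\<in>E. s * x e - c * y e)) = gauss E \<Otimes>\<^sub>M gauss E"
    (is "distr ?M ?M ?T = ?M")
proof (rule measure_eqI)
  fix A assume "A \<in> sets (distr ?M ?M ?T)"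
  then have A[measurable]: "A \<in> sets ?M" by simp
  have [measurable]: "?T \<in> measurable ?M ?M" by measurable
  have "emeasure (distr ?M ?M ?T) A = (\<integral>\<^sup>+p. indicator A p \<partial>distr ?M ?M ?T)"
    by simp
  also have "\<dots> = (\<integral>\<^sup>+p. indicator A (?T p) \<partial>?M)"
    by (rule nn_integral_distr) measurable
  also have "\<dots> = (\<integral>\<^sup>+x. \<integral>\<^sup>+y. indicator A (?T (x, y)) \<partial>gauss E \<partial>gauss E)"
    by (rule gauss.nn_integral_fst[symmetric]) measurable
  also have "\<dots> = (\<integral>\<^sup>+x. \<integral>\<^sup>+y. indicator A (x, y) \<partial>gauss E \<partial>gauss E)"
    using nn_integral_gauss_reflection[OF assms, of "\<lambda>x y. indicator A (x, y)"] by simp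
  also have "\<dots> = (\<integral>\<^sup>+p. indicator A p \<partial>?M)"
    by (rule gauss.nn_integral_fst) measurable
  finally show "emeasure (distr ?M ?M ?T) A = emeasure ?M A"
    by simp
qed simp

text \<open>Bounded measurable functions of the coordinates in \<open>E\<close>. The product measure
  lives on extensional functions, but the arguments that occur, such as
  \<open>\<lambda>e. x e + r * z e\<close>, are not extensional; insensitivity to
  \<open>restrict\<close> bridges the two. Boundedness makes every integral below converge.\<close>

definition tame :: "'i set \<Rightarrow> (('i \<Rightarrow> real) \<Rightarrow> real) \<Rightarrow> bool" where
  "tame E f \<longleftrightarrow> (\<forall>x. f (restrict x E) = f x) \<and> f \<in> borel_measurable (PiM E (\<lambda>_. borel)) \<and>
     (\<exists>B. \<forall>x. \<bar>f x\<bar> \<le> B)"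

lemma tame_compose:
  assumes "tame E f" "\<And>e. e \<in> E \<Longrightarrow> (\<lambda>\<omega>. X \<omega> e) \<in> borel_measurable M"
  shows "(\<lambda>\<omega>. f (X \<omega>)) \<in> borel_measurable M"
proof -
  have "(\<lambda>\<omega>. f (restrict (X \<omega>) E)) \<in> borel_measurable M"
    using assms by (intro measurable_compose[OF measurable_restrict]) (auto simp: tame_def)
  then show ?thesis using assms(1) by (simp add: tame_def)
qed

lemma tame_bound:
  assumes "tame E f"
  obtains B where "\<And>x. \<bar>f x\<bar> \<le> B" "B \<ge> 0"
proof -
  obtain B where "\<And>x. \<bar>f x\<bar> \<le> B" using assms unfolding tame_def by blast
  moreover from this[of undefined] have "B \<ge> 0" using abs_ge_zero order_trans by blast
  ultimately show ?thesis using that by blast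
qed

lemma tame_restrict: "tame E f \<Longrightarrow> f (restrict x E) = f x"
  by (simp add: tame_def)

lemma tame_cong:
  assumes "tame E f" "\<And>e. e \<in> E \<Longrightarrow> x e = y e"
  shows "f x = f y"
proof -
  have "restrict x E = restrict y E" using assms(2) by (auto simp: fun_eq_iff restrict_def)
  then show ?thesis using tame_restrict[OF assms(1)] by metis
qed

lemma tameI:
  assumes "\<And>x. f (restrict x E) = f x" "f \<in> borel_measurable (PiM E (\<lambda>_. borel))" "\<And>x. \<bar>f x\<bar> \<le> B"
  shows "tame E f"
  using assms unfolding tame_def by blast

lemma tame_measurable: "tame E f \<Longrightarrow> f \<in> borel_measurable (PiM E (\<lambda>_. borel))"
  by (simp add: tame_def)

lemma tame_const [simp]: "tame E (\<lambda>_. r)"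
  by (rule tameI[where B="\<bar>r\<bar>"]) auto

lemma tame_add:
  assumes "tame E f" "tame E g" shows "tame E (\<lambda>x. f x + g x)"
proof -
  obtain A B where "\<And>x. \<bar>f x\<bar> \<le> A" "\<And>x. \<bar>g x\<bar> \<le> B" using tame_bound assms by metis
  then have "\<bar>f x + g x\<bar> \<le> A + B" for x by (meson abs_triangle_ineq add_mono order_trans)
  then show ?thesis using assms
    by (intro tameI[where B="A + B"]) (auto simp: tame_restrict tame_measurable intro!: borel_measurable_add)
qed

lemma tame_mult:
  assumes "tame E f" "tame E g" shows "tame E (\<lambda>x. f x * g x)"
proof -
  obtain A B where "\<And>x. \<bar>f x\<bar> \<le> A" "A \<ge> 0" "\<And>x. \<bar>g x\<bar> \<le> B" using tame_bound assms by metis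
  then have "\<bar>f x * g x\<bar> \<le> A * B" for x by (simp add: abs_mult mult_mono')
  then show ?thesis using assms
    by (intro tameI[where B="A * B"]) (auto simp: tame_restrict tame_measurable intro!: borel_measurable_times)
qed

lemma tame_power: "tame E f \<Longrightarrow> tame E (\<lambda>x. f x ^ n)"
  by (induction n) (auto intro: tame_mult)

lemma tame_diff: "tame E f \<Longrightarrow> tame E g \<Longrightarrow> tame E (\<lambda>x. f x - g x)"
  using tame_add[of E f "\<lambda>x. (-1) * g x"] tame_mult[of E "\<lambda>_. -1" g] by simp

lemma tame_sum: "(\<And>i. i \<in> I \<Longrightarrow> tame E (f i)) \<Longrightarrow> tame E (\<lambda>x. \<Sum>i\<in>I. f i x)"
  by (induction I rule: infinite_finite_induct) (auto intro: tame_add)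

lemma tame_affine:
  assumes "tame E f" shows "tame E (\<lambda>z. f (\<lambda>e. x e + r * z e))"
proof -
  obtain B where "\<And>x. \<bar>f x\<bar> \<le> B" using tame_bound assms by metis
  moreover have "(\<lambda>z. f (\<lambda>e. x e + r * z e)) \<in> borel_measurable (PiM E (\<lambda>_. borel))"
    by (rule tame_compose[OF assms]) measurable
  ultimately show ?thesis
    by (intro tameI tame_cong[OF assms]) auto
qed

lemma integrable_tame:
  assumes "tame E f" shows "integrable (gauss E) f"
proof -
  obtain B where "\<And>x. \<bar>f x\<bar> \<le> B" using tame_bound assms by metis
  then show ?thesis using tame_measurable[OF assms]
    by (intro gauss.integrable_const_bound[where B=B])
       (auto simp: measurable_cong_sets[OF sets_gauss refl])
qed

text \<open>The heat semigroup in the couplings; \<open>c\<close> is the variance of the added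
  noise, not its standard deviation.\<close>

definition gconv :: "'i set \<Rightarrow> real \<Rightarrow> (('i \<Rightarrow> real) \<Rightarrow> real) \<Rightarrow> ('i \<Rightarrow> real) \<Rightarrow> real" where
  "gconv E c f x = (\<integral>z. f (\<lambda>e. x e + sqrt c * z e) \<partial>gauss E)"

lemma integrable_gconv: "tame E f \<Longrightarrow> integrable (gauss E) (\<lambda>z. f (\<lambda>e. x e + r * z e))"
  by (intro integrable_tame tame_affine)

lemma gconv_abs_le:
  assumes "tame E f" "\<And>x. \<bar>f x\<bar> \<le> B" shows "\<bar>gconv E c f x\<bar> \<le> B"
proof -
  have "\<bar>gconv E c f x\<bar> \<le> (\<integral>z. \<bar>f (\<lambda>e. x e + sqrt c * z e)\<bar> \<partial>gauss E)"
    unfolding gconv_def by (rule integral_abs_bound)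
  also have "\<dots> \<le> (\<integral>z. B \<partial>gauss E)"
    using assms by (intro integral_mono integrable_abs integrable_gconv) auto
  finally show ?thesis by (simp add: gauss.prob_space)
qed

lemma tame_gconv [intro]:
  assumes f: "tame E f" shows "tame E (gconv E c f)"
proof -
  obtain B where B: "\<And>x. \<bar>f x\<bar> \<le> B" using tame_bound f by metis
  have "(\<lambda>(x, z). f (\<lambda>e. x e + sqrt c * z e)) \<in> borel_measurable (PiM E (\<lambda>_. borel) \<Otimes>\<^sub>M gauss E)"
    unfolding case_prod_beta by (rule tame_compose[OF f]) measurable
  then have "gconv E c f \<in> borel_measurable (PiM E (\<lambda>_. borel))"
    unfolding gconv_def by (intro gauss.borel_measurable_lebesgue_integral)
  moreover have "gconv E c f (restrict x E) = gconv E c f x" for x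
    unfolding gconv_def by (intro Bochner_Integration.integral_cong refl tame_cong[OF f]) auto
  ultimately show ?thesis
    using gconv_abs_le[OF f B] by (intro tameI)
qed

lemma gconv_mono:
  "tame E f \<Longrightarrow> tame E g \<Longrightarrow> (\<And>x. f x \<le> g x) \<Longrightarrow> gconv E c f x \<le> gconv E c g x"
  unfolding gconv_def by (intro integral_mono integrable_gconv)

lemma gconv_nonneg: "(\<And>x. 0 \<le> f x) \<Longrightarrow> 0 \<le> gconv E c f x"
  unfolding gconv_def by (intro Bochner_Integration.integral_nonneg) auto

lemma gconv_add:
  "tame E f \<Longrightarrow> tame E g \<Longrightarrow> gconv E c (\<lambda>x. f x + g x) x = gconv E c f x + gconv E c g x"
  unfolding gconv_def by (intro Bochner_Integration.integral_add integrable_gconv)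

lemma gconv_diff:
  "tame E f \<Longrightarrow> tame E g \<Longrightarrow> gconv E c (\<lambda>x. f x - g x) x = gconv E c f x - gconv E c g x"
  unfolding gconv_def by (intro Bochner_Integration.integral_diff integrable_gconv)

lemma gconv_cmult: "gconv E c (\<lambda>x. r * f x) x = r * gconv E c f x"
  unfolding gconv_def by simp

lemma gconv_const [simp]: "gconv E c (\<lambda>_. r) x = r"
  unfolding gconv_def by (simp add: gauss.prob_space)

lemma gconv_zero [simp]: "gconv E 0 f x = f x"
  unfolding gconv_def by (simp add: gauss.prob_space)

lemma gconv_sum:
  "(\<And>i. i \<in> I \<Longrightarrow> tame E (f i)) \<Longrightarrow> gconv E c (\<lambda>x. \<Sum>i\<in>I. f i x) x = (\<Sum>i\<in>I. gconv E c (f i) x)"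
  unfolding gconv_def by (intro Bochner_Integration.integral_sum integrable_gconv)

lemma integral_gauss_reflection:
  fixes F :: "('i \<Rightarrow> real) \<Rightarrow> ('i \<Rightarrow> real) \<Rightarrow> real"
  assumes E: "finite E" "c\<^sup>2 + s\<^sup>2 = 1" "s > 0"
    and F[measurable]: "(\<lambda>(x, y). F x y) \<in> borel_measurable (PiM E (\<lambda>_. borel) \<Otimes>\<^sub>M PiM E (\<lambda>_. borel))"
    and B: "\<And>x y. \<bar>F x y\<bar> \<le> B"
  shows "(\<integral>x. \<integral>y. F (\<lambda>e\<in>E. c * x e + s * y e) (\<lambda>e\<in>E. s * x e - c * y e) \<partial>gauss E \<partial>gauss E) =
    (\<integral>x. \<integral>y. F x y \<partial>gauss E \<partial>gauss E)"
proof -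
  let ?M = "gauss E \<Otimes>\<^sub>M gauss E"
  let ?T = "\<lambda>(x, y). (\<lambda>e\<in>E. c * x e + s * y e, \<lambda>e\<in>E. s * x e - c * y e)"
  have [measurable]: "?T \<in> measurable ?M ?M" by measurable
  have "(\<integral>x. \<integral>y. F x y \<partial>gauss E \<partial>gauss E) = (\<integral>p. (case p of (x, y) \<Rightarrow> F x y) \<partial>?M)"
    using B by (intro gauss2.integral_fst gauss2.P.integrable_const_bound[where B=B]) (auto, measurable)
  also have "\<dots> = (\<integral>p. (case p of (x, y) \<Rightarrow> F x y) \<partial>distr ?M ?M ?T)"
    by (simp only: distr_gauss_reflection[OF E])
  also have "\<dots> = (\<integral>p. (case ?T p of (x, y) \<Rightarrow> F x y) \<partial>?M)"
    by (rule integral_distr) measurable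
  also have "\<dots> = (\<integral>p. (case p of (x, y) \<Rightarrow> F (\<lambda>e\<in>E. c * x e + s * y e) (\<lambda>e\<in>E. s * x e - c * y e)) \<partial>?M)"
    by (simp add: case_prod_beta)
  also have "\<dots> = (\<integral>x. \<integral>y. F (\<lambda>e\<in>E. c * x e + s * y e) (\<lambda>e\<in>E. s * x e - c * y e) \<partial>gauss E \<partial>gauss E)"
    using B by (intro gauss2.integral_fst[symmetric] gauss2.P.integrable_const_bound[where B=B]) (auto, measurable)
  finally show ?thesis by simp
qed

text \<open>The sum of independent noises of variances \<open>b\<close> and \<open>c\<close> is
  \<open>sqrt (b + c)\<close> times the first component of a reflected Gaussian pair. The second
  component is integrated away, which is why \<open>F\<close> ignores its second argument. The case
  \<open>c = 0\<close> is split off because the reflection requires a positive coefficient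
  \<open>S\<close>.\<close>

lemma gconv_gconv:
  assumes f: "tame E f" and E: "finite E" and bc: "b \<ge> 0" "c \<ge> 0"
  shows "gconv E b (gconv E c f) x = gconv E (b + c) f x"
proof (cases "c = 0")
  case True
  then have "gconv E c f = f" by (simp add: fun_eq_iff)
  with True show ?thesis by simp
next
  case False
  then have c: "c > 0" and d: "b + c > 0" using bc by auto
  obtain B where B: "\<And>x. \<bar>f x\<bar> \<le> B" using tame_bound f by metis
  define C S where "C = sqrt (b / (b + c))" and "S = sqrt (c / (b + c))"
  have CS: "C\<^sup>2 + S\<^sup>2 = 1" "S > 0"
    using bc c d by (auto simp: C_def S_def simp flip: add_divide_distrib)
  have r: "sqrt (b + c) * C = sqrt b" "sqrt (b + c) * S = sqrt c"
    using bc c d by (auto simp: C_def S_def simp flip: real_sqrt_mult)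
  define F where "F = (\<lambda>y (_ :: 'a \<Rightarrow> real). f (\<lambda>e. x e + sqrt (b + c) * y e))"
  have "gconv E b (gconv E c f) x = (\<integral>w. \<integral>z. f (\<lambda>e. x e + sqrt b * w e + sqrt c * z e) \<partial>gauss E \<partial>gauss E)"
    by (simp add: gconv_def)
  also have "\<dots> = (\<integral>w. \<integral>z. F (\<lambda>e\<in>E. C * w e + S * z e) (\<lambda>e\<in>E. S * w e - C * z e) \<partial>gauss E \<partial>gauss E)"
    unfolding F_def
    by (intro Bochner_Integration.integral_cong refl tame_cong[OF f])
       (simp add: distrib_left r flip: mult.assoc)
  also have "\<dots> = (\<integral>w. \<integral>z. F w z \<partial>gauss E \<partial>gauss E)"
  proof (rule integral_gauss_reflection[OF E CS])
    show "(\<lambda>(x, y). F x y) \<in> borel_measurable (PiM E (\<lambda>_. borel) \<Otimes>\<^sub>M PiM E (\<lambda>_. borel))"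
      unfolding F_def case_prod_beta by (rule tame_compose[OF f]) measurable
    show "\<bar>F x y\<bar> \<le> B" for x y
      by (simp add: F_def B)
  qed
  also have "\<dots> = gconv E (b + c) f x"
    by (simp add: F_def gconv_def gauss.prob_space)
  finally show ?thesis .
qed

text \<open>Splitting the noise that correlates two copies symmetrically between them shows that
  the correlation of \<open>f\<close> at two Gaussian vectors is a square, hence nonnegative.\<close>

lemma integral_correlated_eq_gconv:
  assumes f: "tame E f" and E: "finite E" and \<rho>: "0 \<le> \<rho>" "\<rho> \<le> 1"
  shows "(\<integral>g. f g * gconv E (1 - \<rho>\<^sup>2) f (\<lambda>e. \<rho> * g e) \<partial>gauss E) =
    gconv E \<rho> (\<lambda>x. (gconv E (1 - \<rho>) f x)\<^sup>2) (\<lambda>_. 0)"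
proof (cases "\<rho> = 1")
  case True
  then show ?thesis by (simp add: gconv_def power2_eq_square gauss.prob_space)
next
  case False
  then have s: "sqrt (1 - \<rho>) > 0" using \<rho> by simp
  define q where "q = gconv E (1 - \<rho>) f"
  have q: "tame E q" unfolding q_def using f by blast
  obtain A where A: "\<And>x. \<bar>f x\<bar> \<le> A" "A \<ge> 0" using tame_bound f by metis
  obtain B where B: "\<And>x. \<bar>q x\<bar> \<le> B" using tame_bound q by metis
  have cs: "(sqrt \<rho>)\<^sup>2 + (sqrt (1 - \<rho>))\<^sup>2 = 1" using \<rho> by simp
  have rr: "sqrt \<rho> * sqrt \<rho> = \<rho>" "sqrt (1 - \<rho>) * sqrt (1 - \<rho>) = 1 - \<rho>" using \<rho> by simp_all
  \<comment> \<open>The reflection undone: if x and y are the two reflected vectors, the common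
    noise h equals sqrt \<rho> x + sqrt (1 - \<rho>) y, so \<open>q\<close> can be evaluated in
    terms of x and y.\<close>
  have inv: "sqrt \<rho> * (sqrt \<rho> * u + sqrt (1 - \<rho>) * v) + sqrt (1 - \<rho>) * (sqrt (1 - \<rho>) * u - sqrt \<rho> * v) = u"
    for u v :: real
  proof -
    have "sqrt \<rho> * (sqrt \<rho> * u + sqrt (1 - \<rho>) * v) + sqrt (1 - \<rho>) * (sqrt (1 - \<rho>) * u - sqrt \<rho> * v) =
        (sqrt \<rho> * sqrt \<rho> + sqrt (1 - \<rho>) * sqrt (1 - \<rho>)) * u"
      by algebra
    also have "\<dots> = u" by (simp only: rr) simp
    finally show ?thesis .
  qed
  have scale: "sqrt \<rho> * (sqrt \<rho> * u + sqrt (1 - \<rho>) * v) = \<rho> * u + sqrt \<rho> * sqrt (1 - \<rho>) * v" for u v :: real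
    by (simp only: distrib_left mult.assoc[symmetric] rr)
  define F where "F = (\<lambda>x y. f x * q (\<lambda>e. sqrt \<rho> * (sqrt \<rho> * x e + sqrt (1 - \<rho>) * y e)))"
  have "gconv E \<rho> (\<lambda>x. (q x)\<^sup>2) (\<lambda>_. 0) =
      (\<integral>h. q (\<lambda>e. sqrt \<rho> * h e) * (\<integral>z. f (\<lambda>e. sqrt \<rho> * h e + sqrt (1 - \<rho>) * z e) \<partial>gauss E) \<partial>gauss E)"
    by (simp add: gconv_def power2_eq_square) (simp add: q_def gconv_def)
  also have "\<dots> = (\<integral>h. \<integral>z. f (\<lambda>e. sqrt \<rho> * h e + sqrt (1 - \<rho>) * z e) * q (\<lambda>e. sqrt \<rho> * h e) \<partial>gauss E \<partial>gauss E)"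
    by (simp add: mult.commute)
  also have "\<dots> = (\<integral>h. \<integral>z. F (\<lambda>e\<in>E. sqrt \<rho> * h e + sqrt (1 - \<rho>) * z e) (\<lambda>e\<in>E. sqrt (1 - \<rho>) * h e - sqrt \<rho> * z e) \<partial>gauss E \<partial>gauss E)"
    unfolding F_def
    by (intro Bochner_Integration.integral_cong refl arg_cong2[where f="(*)"] tame_cong[OF f] tame_cong[OF q])
       (auto simp: inv)
  also have "\<dots> = (\<integral>x. \<integral>y. F x y \<partial>gauss E \<partial>gauss E)"
  proof (rule integral_gauss_reflection[OF E cs s])
    show "(\<lambda>(x, y). F x y) \<in> borel_measurable (PiM E (\<lambda>_. borel) \<Otimes>\<^sub>M PiM E (\<lambda>_. borel))"
      unfolding F_def case_prod_beta
      by (intro borel_measurable_times tame_compose[OF f] tame_compose[OF q]) measurable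
    show "\<bar>F x y\<bar> \<le> A * B" for x y
      unfolding F_def abs_mult using A B by (intro mult_mono) auto
  qed
  also have "\<dots> = (\<integral>x. f x * gconv E (\<rho> * (1 - \<rho>)) q (\<lambda>e. \<rho> * x e) \<partial>gauss E)"
    unfolding F_def gconv_def real_sqrt_mult
    by (simp add: scale)
  \<comment> \<open>The variances add up by the semigroup property: \<rho> (1 - \<rho>) + (1 -
    \<rho>) = 1 - \<rho>^2.\<close>
  also have "\<dots> = (\<integral>x. f x * gconv E (1 - \<rho>\<^sup>2) f (\<lambda>e. \<rho> * x e) \<partial>gauss E)"
    unfolding q_def using \<rho>
    by (subst gconv_gconv[OF f E]) (auto simp: algebra_simps power2_eq_square mult_left_le)
  finally show ?thesis by (simp add: q_def)
qed

section \<open>Infinitesimal Gaussian noise\<close>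

lemma integral_gauss_prod:
  fixes f :: "'i \<Rightarrow> real \<Rightarrow> real"
  assumes "finite E" "\<And>i. i \<in> E \<Longrightarrow> integrable std_normal_distribution (f i)"
  shows "integrable (gauss E) (\<lambda>x. \<Prod>i\<in>E. f i (x i))"
    and "(\<integral>x. (\<Prod>i\<in>E. f i (x i)) \<partial>gauss E) = (\<Prod>i\<in>E. \<integral>x. f i x \<partial>std_normal_distribution)"
  unfolding gauss_def
  using product_sigma_finite.product_integrable_prod[OF product_sigma_finite_std_normal assms]
    product_sigma_finite.product_integral_prod[OF product_sigma_finite_std_normal assms] by auto

lemma integrable_std_normal_power_abs: "integrable std_normal_distribution (\<lambda>x. \<bar>x\<bar> ^ k)"
  using integrable_std_normal_moment_abs[of k] by (subst integrable_density) auto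

lemma integrable_std_normal_power: "integrable std_normal_distribution (\<lambda>x. x ^ k)"
  using integrable_std_normal_moment[of k] by (subst integrable_density) auto

lemma integral_std_normal_first: "(\<integral>x. x \<partial>std_normal_distribution) = 0"
  using integral_std_normal_moment_odd[of 0] by (subst integral_density) auto

lemma integral_std_normal_second: "(\<integral>x. x * x \<partial>std_normal_distribution) = 1"
  using integral_std_normal_moment_even[of 1]
  by (subst integral_density) (auto simp: power2_eq_square)

lemma gauss_covariance:
  assumes E: "finite E" "e \<in> E" "e' \<in> E"
  shows "integrable (gauss E) (\<lambda>x. x e * x e')"
    and "(\<integral>x. x e * x e' \<partial>gauss E) = (if e = e' then 1 else 0)"
proof -
  interpret \<gamma>: prob_space std_normal_distribution by (rule prob_space_std_normal)
  \<comment> \<open>Writes the product of two coordinates as a product over all of \<open>E\<close>,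
    the cases \<open>e = e'\<close> and \<open>e \<noteq> e'\<close> alike; each factor is x^2, x or
    1.\<close>
  define f where "f = (\<lambda>i (x :: real). (if i = e then x else 1) * (if i = e' then x else 1))"
  have int: "integrable std_normal_distribution (f i)" for i
  proof -
    consider "f i = (\<lambda>x. x ^ 2)" | "f i = (\<lambda>x. x ^ 1)" | "f i = (\<lambda>x. x ^ 0)"
      by (cases "i = e"; cases "i = e'") (auto simp: f_def power2_eq_square)
    then show ?thesis by cases (auto simp only: integrable_std_normal_power)
  qed
  have prod: "(\<Prod>i\<in>E. f i (x i)) = x e * x e'" for x
    using E by (simp add: f_def prod.distrib)
  show "integrable (gauss E) (\<lambda>x. x e * x e')"
    using integral_gauss_prod(1)[of E f, OF E(1) int] by (simp add: prod)
  have "(\<integral>x. x e * x e' \<partial>gauss E) = (\<Prod>i\<in>E. \<integral>x. f i x \<partial>std_normal_distribution)"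
    using integral_gauss_prod(2)[of E f, OF E(1) int] by (simp add: prod)
  also have "\<dots> = (if e = e' then 1 else 0)"
  proof (cases "e = e'")
    case True
    then have "(\<integral>x. f i x \<partial>std_normal_distribution) = 1" for i
      by (cases "i = e") (use \<gamma>.prob_space in \<open>simp_all add: f_def integral_std_normal_second\<close>)
    with True show ?thesis by simp
  next
    case False
    then have "(\<integral>x. f e x \<partial>std_normal_distribution) = 0"
      by (simp add: f_def integral_std_normal_first)
    with False E show ?thesis by (auto intro!: prod_zero)
  qed
  finally show "(\<integral>x. x e * x e' \<partial>gauss E) = (if e = e' then 1 else 0)" .
qed

text \<open>The l1 norm is the convenient one because spins have modulus 1: it bounds the effect of
  a change of couplings on the Hamiltonian uniformly over all configurations. Only finiteness of its
  Gaussian moments matters, as they enter nothing but vanishing errors.\<close>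

definition norm1 :: "'i set \<Rightarrow> ('i \<Rightarrow> real) \<Rightarrow> real" where
  "norm1 E w = (\<Sum>e\<in>E. \<bar>w e\<bar>)"

definition moment1 :: "'i set \<Rightarrow> nat \<Rightarrow> real" where
  "moment1 E k = (\<integral>w. norm1 E w ^ k \<partial>gauss E)"

lemma norm1_nonneg: "norm1 E w \<ge> 0"
  by (simp add: norm1_def sum_nonneg)

lemma norm1_scale: "norm1 E (\<lambda>e. r * w e) = \<bar>r\<bar> * norm1 E w"
  by (simp add: norm1_def abs_mult sum_distrib_left)

lemma norm1_measurable [measurable]: "norm1 E \<in> borel_measurable (PiM E (\<lambda>_. borel))"
  unfolding norm1_def by measurable

lemma norm1_power_le:
  assumes "finite E" "E \<noteq> {}"
  shows "norm1 E w ^ k \<le> real (card E) ^ k * (\<Sum>e\<in>E. \<bar>w e\<bar> ^ k)"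
proof -
  have "Max ((\<lambda>e. \<bar>w e\<bar>) ` E) \<in> (\<lambda>e. \<bar>w e\<bar>) ` E"
    using assms by (intro Max_in) auto
  then obtain e where e: "e \<in> E" "Max ((\<lambda>e. \<bar>w e\<bar>) ` E) = \<bar>w e\<bar>"
    by (rule imageE)
  have "norm1 E w \<le> (\<Sum>_\<in>E. \<bar>w e\<bar>)"
    unfolding norm1_def e(2)[symmetric] using assms by (intro sum_mono Max_ge) auto
  then have "norm1 E w ^ k \<le> (real (card E) * \<bar>w e\<bar>) ^ k"
    by (intro power_mono norm1_nonneg) simp
  also have "\<dots> \<le> real (card E) ^ k * (\<Sum>e\<in>E. \<bar>w e\<bar> ^ k)"
    unfolding power_mult_distrib using assms e(1)
    by (intro mult_left_mono member_le_sum[of e E "\<lambda>e. \<bar>w e\<bar> ^ k"]) auto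
  finally show ?thesis .
qed

lemma integrable_norm1_power:
  assumes E: "finite E"
  shows "integrable (gauss E) (\<lambda>w. norm1 E w ^ k)"
proof (cases "E = {}")
  case True
  then show ?thesis by (simp add: norm1_def)
next
  case False
  have "integrable (gauss E) (\<lambda>w. \<bar>w e\<bar> ^ k)" if e: "e \<in> E" for e
  proof -
    have "integrable (gauss E) (\<lambda>w. \<Prod>i\<in>E. (if i = e then \<bar>w i\<bar> ^ k else 1))"
      using integrable_std_normal_power_abs[of k] integrable_std_normal_power[of 0]
      by (intro integral_gauss_prod(1)[OF E, of "\<lambda>i x. if i = e then \<bar>x\<bar> ^ k else 1"])
         (rename_tac i, case_tac "i = e", simp_all)
    then show ?thesis using e E by simp
  qed
  then have "integrable (gauss E) (\<lambda>w. real (card E) ^ k * (\<Sum>e\<in>E. \<bar>w e\<bar> ^ k))"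
    by auto
  then show ?thesis
  proof (rule Bochner_Integration.integrable_bound)
    show "AE w in gauss E. norm (norm1 E w ^ k) \<le> norm (real (card E) ^ k * (\<Sum>e\<in>E. \<bar>w e\<bar> ^ k))"
      using norm1_power_le[OF E False] norm1_nonneg
      by (intro AE_I2) (simp add: abs_mult sum_nonneg power_abs abs_of_nonneg[OF norm1_nonneg])
  qed measurable
qed

lemma moment1_nonneg: "moment1 E k \<ge> 0"
  unfolding moment1_def by (intro Bochner_Integration.integral_nonneg) (simp add: norm1_nonneg)

text \<open>A quantitative first-order expansion with candidate partial derivatives
  \<open>d\<close>, bounded by \<open>L\<close>, and quadratic remainder constant \<open>M\<close>.
  Being a pointwise inequality instead of a differentiability statement, it can simply be
  integrated.\<close>

definition taylor2 ::
    "'i set \<Rightarrow> (('i \<Rightarrow> real) \<Rightarrow> real) \<Rightarrow> ('i \<Rightarrow> ('i \<Rightarrow> real) \<Rightarrow> real) \<Rightarrow> real \<Rightarrow> real \<Rightarrow> bool" where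
  "taylor2 E f d L M \<longleftrightarrow> tame E f \<and> (\<forall>e\<in>E. tame E (d e) \<and> (\<forall>x. \<bar>d e x\<bar> \<le> L)) \<and>
     (\<forall>x w. \<bar>f (\<lambda>e. x e + w e) - f x - (\<Sum>e\<in>E. w e * d e x)\<bar> \<le> M * (norm1 E w)\<^sup>2)"

text \<open>The expansion is averaged over the noise at a fixed increment \<open>w\<close>.
  Averaging does not worsen the constants, so the error terms do not depend on the amount of private
  noise.\<close>

lemma taylor2_gconv:
  assumes t: "taylor2 E f d L M"
  shows "taylor2 E (gconv E c f) (\<lambda>e. gconv E c (d e)) L M"
proof -
  have f: "tame E f" and d: "\<And>e. e \<in> E \<Longrightarrow> tame E (d e)" "\<And>e x. e \<in> E \<Longrightarrow> \<bar>d e x\<bar> \<le> L"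
    and T: "\<And>x w. \<bar>f (\<lambda>e. x e + w e) - f x - (\<Sum>e\<in>E. w e * d e x)\<bar> \<le> M * (norm1 E w)\<^sup>2"
    using t by (auto simp: taylor2_def)
  have "\<bar>gconv E c f (\<lambda>e. x e + w e) - gconv E c f x - (\<Sum>e\<in>E. w e * gconv E c (d e) x)\<bar> \<le> M * (norm1 E w)\<^sup>2"
    for x w
  proof -
    have g: "tame E (\<lambda>x. f (\<lambda>e. x e + w e))"
      using tame_affine[OF f, of w 1] by (simp add: add.commute)
    have h: "tame E (\<lambda>x. \<Sum>e\<in>E. w e * d e x)"
      by (intro tame_sum tame_mult tame_const d)
    have *: "gconv E c f (\<lambda>e. x e + w e) = gconv E c (\<lambda>x. f (\<lambda>e. x e + w e)) x"
      by (simp add: gconv_def algebra_simps)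
    have "gconv E c f (\<lambda>e. x e + w e) - gconv E c f x - (\<Sum>e\<in>E. w e * gconv E c (d e) x) =
        gconv E c (\<lambda>x. f (\<lambda>e. x e + w e) - f x - (\<Sum>e\<in>E. w e * d e x)) x"
      unfolding * using f g h d
      by (simp add: gconv_diff tame_diff gconv_sum gconv_cmult tame_mult)
    also have "\<bar>\<dots>\<bar> \<le> M * (norm1 E w)\<^sup>2"
      by (intro gconv_abs_le tame_diff f g h T)
    finally show ?thesis .
  qed
  then show ?thesis
    using f d by (auto simp: taylor2_def intro!: gconv_abs_le)
qed

lemma integral_linear_form_square:
  assumes E: "finite E"
  shows "integrable (gauss E) (\<lambda>w. (\<Sum>e\<in>E. w e * r e)\<^sup>2)"
    and "(\<integral>w. (\<Sum>e\<in>E. w e * r e)\<^sup>2 \<partial>gauss E) = (\<Sum>e\<in>E. (r e)\<^sup>2)"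
proof -
  have eq: "(\<Sum>e\<in>E. w e * r e)\<^sup>2 = (\<Sum>e\<in>E. \<Sum>e'\<in>E. (r e * r e') * (w e * w e'))" for w
    by (simp add: power2_eq_square sum_product ac_simps)
  show "integrable (gauss E) (\<lambda>w. (\<Sum>e\<in>E. w e * r e)\<^sup>2)"
    unfolding eq using gauss_covariance(1)[OF E] by auto
  have "(\<integral>w. (\<Sum>e\<in>E. w e * r e)\<^sup>2 \<partial>gauss E) = (\<Sum>e\<in>E. \<Sum>e'\<in>E. (r e * r e') * (if e = e' then 1 else 0))"
    unfolding eq using gauss_covariance[OF E]
    by (simp add: Bochner_Integration.integral_sum cong: sum.cong)
  also have "\<dots> = (\<Sum>e\<in>E. (r e)\<^sup>2)"
    using E by (simp add: power2_eq_square if_distrib[where f="\<lambda>t. _ * t"] cong: if_cong)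
  finally show "(\<integral>w. (\<Sum>e\<in>E. w e * r e)\<^sup>2 \<partial>gauss E) = (\<Sum>e\<in>E. (r e)\<^sup>2)" .
qed

text \<open>A first-order Gaussian Poincare inequality: for small noise only the
  linear part of \<open>q\<close> matters.\<close>

lemma gconv_variance_le:
  assumes t: "taylor2 E q d L M" and E: "finite E" and b: "0 \<le> b" "b \<le> 1" and LM: "L \<ge> 0" "M \<ge> 0"
  shows "gconv E b (\<lambda>x. (q x)\<^sup>2) x - (gconv E b q x)\<^sup>2
    \<le> b * (\<Sum>e\<in>E. (d e x)\<^sup>2) + b * sqrt b * (2 * L * M * moment1 E 3 + M\<^sup>2 * moment1 E 4)"
proof -
  have q: "tame E q" and d: "\<And>e. e \<in> E \<Longrightarrow> \<bar>d e x\<bar> \<le> L"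
    and T: "\<And>x w. \<bar>q (\<lambda>e. x e + w e) - q x - (\<Sum>e\<in>E. w e * d e x)\<bar> \<le> M * (norm1 E w)\<^sup>2"
    using t by (auto simp: taylor2_def)
  \<comment> \<open>Centring at \<open>q x\<close> instead of at the mean only increases the second
    moment, and the increment from \<open>x\<close> has an explicit linear part.\<close>
  define D where "D = (\<lambda>w. q (\<lambda>e. x e + sqrt b * w e) - q x)"
  have tD: "tame E D"
    unfolding D_def by (intro tame_diff tame_affine[OF q] tame_const)
  have D2: "(D w)\<^sup>2 \<le> b * (\<Sum>e\<in>E. w e * d e x)\<^sup>2 +
      b * sqrt b * (2 * L * M * norm1 E w ^ 3 + M\<^sup>2 * norm1 E w ^ 4)" for w
  proof -
    define Y R l where "Y = (\<Sum>e\<in>E. w e * d e x)" and "R = D w - sqrt b * Y" and "l = norm1 E w"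
    have l: "l \<ge> 0" by (simp add: l_def norm1_nonneg)
    have s: "sqrt b \<ge> 0" "sqrt b * sqrt b = b" "sqrt b \<le> 1" using b by auto
    have "\<bar>Y\<bar> \<le> (\<Sum>e\<in>E. \<bar>w e\<bar> * L)"
      unfolding Y_def by (intro sum_abs[THEN order_trans] sum_mono) (auto simp: abs_mult intro!: mult_left_mono d)
    then have Y: "\<bar>Y\<bar> \<le> L * l" by (simp add: l_def norm1_def sum_distrib_left mult.commute)
    have R: "\<bar>R\<bar> \<le> b * (M * l\<^sup>2)"
      using T[of x "\<lambda>e. sqrt b * w e"] b
      by (simp add: R_def D_def Y_def l_def norm1_scale power_mult_distrib sum_distrib_left algebra_simps)
    have "2 * sqrt b * (Y * R) \<le> 2 * sqrt b * ((L * l) * (b * (M * l\<^sup>2)))"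
    proof (intro mult_left_mono)
      have "Y * R \<le> \<bar>Y\<bar> * \<bar>R\<bar>" by (metis abs_ge_self abs_mult)
      also have "\<dots> \<le> (L * l) * (b * (M * l\<^sup>2))" using Y R LM l by (intro mult_mono) auto
      finally show "Y * R \<le> (L * l) * (b * (M * l\<^sup>2))" .
    qed (use s in auto)
    also have "\<dots> = b * sqrt b * (2 * L * M * l ^ 3)"
      by (simp add: power2_eq_square power3_eq_cube)
    finally have 1: "2 * sqrt b * (Y * R) \<le> b * sqrt b * (2 * L * M * l ^ 3)" .
    have "R\<^sup>2 \<le> (b * (M * l\<^sup>2))\<^sup>2"
      using R by (metis abs_ge_zero power2_abs power_mono)
    also have "\<dots> = b * (b * (M\<^sup>2 * l ^ 4))"
      by (simp add: power_mult_distrib power2_eq_square power4_eq_xxxx)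
    \<comment> \<open>The squared remainder has order b^2; since \<open>b \<le> 1\<close> it is
      weakened to b^(3/2), the order of the cross term.\<close>
    also have "\<dots> \<le> b * (sqrt b * (M\<^sup>2 * l ^ 4))"
    proof (intro mult_left_mono mult_right_mono)
      show "b \<le> sqrt b" using s b by (metis mult_left_le)
    qed (use b l in auto)
    finally have 2: "R\<^sup>2 \<le> b * sqrt b * (M\<^sup>2 * l ^ 4)" by simp
    have "(D w)\<^sup>2 = (sqrt b * Y + R)\<^sup>2" by (simp add: R_def)
    also have "\<dots> = (sqrt b * sqrt b) * Y\<^sup>2 + 2 * sqrt b * (Y * R) + R\<^sup>2"
      by algebra
    also have "\<dots> \<le> b * Y\<^sup>2 + b * sqrt b * (2 * L * M * l ^ 3) + b * sqrt b * (M\<^sup>2 * l ^ 4)"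
      unfolding s(2) using 1 2 by linarith
    finally show ?thesis by (simp add: Y_def l_def algebra_simps)
  qed
  have iq: "integrable (gauss E) (\<lambda>w. q (\<lambda>e. x e + sqrt b * w e))"
    by (rule integrable_gconv[OF q])
  have iq2: "integrable (gauss E) (\<lambda>w. (q (\<lambda>e. x e + sqrt b * w e))\<^sup>2)"
    using integrable_gconv[OF tame_power[OF q]] by simp
  have "(\<integral>w. (D w)\<^sup>2 \<partial>gauss E) =
      (\<integral>w. (q (\<lambda>e. x e + sqrt b * w e))\<^sup>2 - 2 * q x * q (\<lambda>e. x e + sqrt b * w e) + (q x)\<^sup>2 \<partial>gauss E)"
    by (intro Bochner_Integration.integral_cong) (simp_all add: D_def power2_eq_square algebra_simps)
  also have "\<dots> = gconv E b (\<lambda>x. (q x)\<^sup>2) x - 2 * q x * gconv E b q x + (q x)\<^sup>2"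
    using iq iq2 by (simp add: gconv_def gauss.prob_space)
  also have "\<dots> = gconv E b (\<lambda>x. (q x)\<^sup>2) x - (gconv E b q x)\<^sup>2 + (gconv E b q x - q x)\<^sup>2"
    by algebra
  finally have "gconv E b (\<lambda>x. (q x)\<^sup>2) x - (gconv E b q x)\<^sup>2 \<le> (\<integral>w. (D w)\<^sup>2 \<partial>gauss E)"
    by simp
  also have "\<dots> \<le> (\<integral>w. b * (\<Sum>e\<in>E. w e * d e x)\<^sup>2 +
      b * sqrt b * (2 * L * M * norm1 E w ^ 3 + M\<^sup>2 * norm1 E w ^ 4) \<partial>gauss E)"
    using integral_linear_form_square(1)[OF E] integrable_norm1_power[OF E]
    by (intro integral_mono[OF integrable_tame[OF tame_power[OF tD]] _ D2]) auto
  also have "\<dots> = b * (\<Sum>e\<in>E. (d e x)\<^sup>2) + b * sqrt b * (2 * L * M * moment1 E 3 + M\<^sup>2 * moment1 E 4)"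
    using integral_linear_form_square[OF E] integrable_norm1_power[OF E]
    by (simp add: moment1_def)
  finally show ?thesis .
qed

text \<open>Only order \<open>sqrt b\<close>, obtained by bounding the linear part in absolute
  value. This is enough because the estimate is later multiplied by a further factor
  \<open>b\<close>.\<close>

lemma gconv_near:
  assumes t: "taylor2 E q d L M" and E: "finite E" and b: "0 \<le> b" "b \<le> 1" and LM: "L \<ge> 0" "M \<ge> 0"
  shows "\<bar>gconv E b q x - q x\<bar> \<le> sqrt b * (L * moment1 E 1 + M * moment1 E 2)"
proof -
  have q: "tame E q" and d: "\<And>e. e \<in> E \<Longrightarrow> \<bar>d e x\<bar> \<le> L"
    and T: "\<And>x w. \<bar>q (\<lambda>e. x e + w e) - q x - (\<Sum>e\<in>E. w e * d e x)\<bar> \<le> M * (norm1 E w)\<^sup>2"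
    using t by (auto simp: taylor2_def)
  define D where "D = (\<lambda>w. q (\<lambda>e. x e + sqrt b * w e) - q x)"
  have tD: "tame E D"
    unfolding D_def by (intro tame_diff tame_affine[OF q] tame_const)
  have D: "\<bar>D w\<bar> \<le> sqrt b * (L * norm1 E w ^ 1 + M * norm1 E w ^ 2)" for w
  proof -
    define Y l where "Y = (\<Sum>e\<in>E. w e * d e x)" and "l = norm1 E w"
    have s: "sqrt b \<ge> 0" "sqrt b * sqrt b = b" "sqrt b \<le> 1" using b by auto
    have "\<bar>Y\<bar> \<le> (\<Sum>e\<in>E. \<bar>w e\<bar> * L)"
      unfolding Y_def by (intro sum_abs[THEN order_trans] sum_mono) (auto simp: abs_mult intro!: mult_left_mono d)
    then have "\<bar>Y\<bar> \<le> L * l" by (simp add: l_def norm1_def sum_distrib_left mult.commute)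
    then have Y: "\<bar>sqrt b * Y\<bar> \<le> sqrt b * (L * l)"
      using s(1) by (simp add: abs_mult mult_left_mono)
    have "\<bar>D w - sqrt b * Y\<bar> \<le> b * (M * l\<^sup>2)"
      using T[of x "\<lambda>e. sqrt b * w e"] b
      by (simp add: D_def Y_def l_def norm1_scale power_mult_distrib sum_distrib_left algebra_simps)
    also have "\<dots> \<le> sqrt b * (M * l\<^sup>2)"
      using s LM b by (intro mult_right_mono) (metis mult_left_le, simp)
    finally show ?thesis using Y unfolding l_def by (simp add: distrib_left)
  qed
  have "gconv E b q x - q x = (\<integral>w. D w \<partial>gauss E)"
    using integrable_gconv[OF q] by (simp add: D_def gconv_def gauss.prob_space)
  also have "\<bar>\<dots>\<bar> \<le> (\<integral>w. \<bar>D w\<bar> \<partial>gauss E)"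
    by (rule integral_abs_bound)
  also have "\<dots> \<le> (\<integral>w. sqrt b * (L * norm1 E w ^ 1 + M * norm1 E w ^ 2) \<partial>gauss E)"
    using integrable_norm1_power[OF E, of 1] integrable_norm1_power[OF E, of 2]
    by (intro integral_mono[OF integrable_abs[OF integrable_tame[OF tD]] _ D]) auto
  also have "\<dots> = sqrt b * (L * moment1 E 1 + M * moment1 E 2)"
    using integrable_norm1_power[OF E, of 1] integrable_norm1_power[OF E, of 2]
    by (simp add: moment1_def)
  finally show ?thesis .
qed

text \<open>Each centred Gaussian coordinate is symmetric and the coordinates are independent. The
  signs that matter later are the products of two spins attached to the bonds by a gauge
  transformation.\<close>

lemma integral_gauss_sign_change:
  assumes f: "tame E f" and E: "finite E" and s: "\<And>e. e \<in> E \<Longrightarrow> s e \<in> {-1, 1}"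
  shows "(\<integral>z. f (\<lambda>e. s e * z e) \<partial>gauss E) = (\<integral>z. f z \<partial>gauss E)"
proof -
  let ?T = "\<lambda>z. \<lambda>e\<in>E. s e * z e"
  let ?\<gamma> = std_normal_distribution
  have flip: "distr ?\<gamma> borel (\<lambda>x. r * x) = ?\<gamma>" if "r \<in> {-1, 1}" for r
  proof (rule measure_eqI)
    fix A assume "A \<in> sets (distr ?\<gamma> borel (\<lambda>x. r * x))"
    then have [measurable]: "A \<in> sets borel" by simp
    have "emeasure (distr ?\<gamma> borel (\<lambda>x. r * x)) A = (\<integral>\<^sup>+x. indicator A x \<partial>distr ?\<gamma> borel (\<lambda>x. r * x))"
      by simp
    also have "\<dots> = (\<integral>\<^sup>+x. ennreal (std_normal_density x) * indicator A (r * x) \<partial>lborel)"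
      by (subst nn_integral_distr) (auto simp: nn_integral_density)
    also have "\<dots> = (\<integral>\<^sup>+x. ennreal (std_normal_density x) * indicator A x \<partial>lborel)"
      using that by (subst (2) nn_integral_real_affine[where c=r and t=0]) (auto simp: std_normal_density_def)
    also have "\<dots> = emeasure ?\<gamma> A"
      by (simp add: emeasure_density)
    finally show "emeasure (distr ?\<gamma> borel (\<lambda>x. r * x)) A = emeasure ?\<gamma> A" .
  qed simp
  have "distr (gauss E) (PiM E (\<lambda>_. ?\<gamma>)) ?T = PiM E (\<lambda>_. ?\<gamma>)"
  proof (rule product_sigma_finite.PiM_eqI[OF product_sigma_finite_std_normal E])
    fix A :: "'a \<Rightarrow> real set" assume "\<And>i. i \<in> E \<Longrightarrow> A i \<in> sets ?\<gamma>"
    then have A: "A i \<in> sets borel" if "i \<in> E" for i using that by simp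
    have "emeasure (distr (gauss E) (PiM E (\<lambda>_. ?\<gamma>)) ?T) (Pi\<^sub>E E A) = emeasure (gauss E) (?T -` Pi\<^sub>E E A \<inter> space (gauss E))"
      using A E unfolding gauss_def by (intro emeasure_distr sets_PiM_I_finite) (auto, measurable)
    also have "?T -` Pi\<^sub>E E A \<inter> space (gauss E) = (\<Pi>\<^sub>E i\<in>E. (\<lambda>x. s i * x) -` A i)"
      by (auto simp: space_gauss PiE_iff extensional_def)
    also have "emeasure (gauss E) \<dots> = (\<Prod>i\<in>E. emeasure ?\<gamma> ((\<lambda>x. s i * x) -` A i))"
      unfolding gauss_def
    proof (rule product_sigma_finite.emeasure_PiM[OF product_sigma_finite_std_normal E])
      fix i assume "i \<in> E"
      then show "(\<lambda>x. s i * x) -` A i \<in> sets ?\<gamma>"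
        using measurable_sets_borel[of "\<lambda>x. s i * x" borel "A i"] A by simp
    qed
    also have "\<dots> = (\<Prod>i\<in>E. emeasure ?\<gamma> (A i))"
    proof (rule prod.cong[OF refl])
      fix i assume i: "i \<in> E"
      have "emeasure (distr ?\<gamma> borel (\<lambda>x. s i * x)) (A i) = emeasure ?\<gamma> ((\<lambda>x. s i * x) -` A i)"
        using A[OF i] by (subst emeasure_distr) auto
      then show "emeasure ?\<gamma> ((\<lambda>x. s i * x) -` A i) = emeasure ?\<gamma> (A i)"
        using flip[OF s[OF i]] by simp
    qed
    finally show "emeasure (distr (gauss E) (PiM E (\<lambda>_. ?\<gamma>)) ?T) (Pi\<^sub>E E A) = (\<Prod>i\<in>E. emeasure ?\<gamma> (A i))" .
  qed simp
  then have eq: "distr (gauss E) (gauss E) ?T = gauss E"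
    by (simp add: gauss_def)
  have [measurable]: "f \<in> borel_measurable (gauss E)"
    using tame_measurable[OF f] by (simp add: measurable_cong_sets[OF sets_gauss refl])
  have "(\<integral>z. f z \<partial>gauss E) = (\<integral>z. f z \<partial>distr (gauss E) (gauss E) ?T)"
    by (simp add: eq)
  also have "\<dots> = (\<integral>z. f (?T z) \<partial>gauss E)"
    by (rule integral_distr) measurable
  also have "\<dots> = (\<integral>z. f (\<lambda>e. s e * z e) \<partial>gauss E)"
    by (intro Bochner_Integration.integral_cong refl tame_cong[OF f]) auto
  finally show ?thesis by simp
qed

section \<open>Gibbs averages\<close>

definition gavg :: "nat \<Rightarrow> real \<Rightarrow> ((nat \<Rightarrow> real) \<Rightarrow> real) \<Rightarrow> (nat \<times> nat \<Rightarrow> real) \<Rightarrow> real" where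
  "gavg N \<beta> u g = (\<Sum>\<sigma>\<in>spin_configs N. gibbs_weight N \<beta> g \<sigma> * u \<sigma>)"

definition bonds :: "nat \<Rightarrow> (nat \<times> nat) set" where
  "bonds N = {1..N} \<times> {1..N}"

lemma finite_bonds [simp]: "finite (bonds N)"
  by (simp add: bonds_def)

lemma gaussian_couplings_eq_gauss: "gaussian_couplings N = gauss (bonds N)"
  by (simp add: gaussian_couplings_def gauss_def bonds_def)

lemma sum_gibbs_weight: "(\<Sum>\<sigma>\<in>spin_configs N. gibbs_weight N \<beta> g \<sigma>) = 1"
  using partition_function_pos[of N \<beta> g]
  by (simp add: gibbs_weight_def partition_function_def flip: sum_divide_distrib)

lemma gavg_abs_le:
  assumes "\<And>\<sigma>. \<sigma> \<in> spin_configs N \<Longrightarrow> \<bar>u \<sigma>\<bar> \<le> B"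
  shows "\<bar>gavg N \<beta> u g\<bar> \<le> B"
proof -
  have "\<bar>gavg N \<beta> u g\<bar> \<le> (\<Sum>\<sigma>\<in>spin_configs N. gibbs_weight N \<beta> g \<sigma> * B)"
    unfolding gavg_def
    by (intro sum_abs[THEN order_trans] sum_mono)
       (auto simp: abs_mult gibbs_weight_nonneg intro!: mult_left_mono assms)
  then show ?thesis by (simp add: sum_gibbs_weight flip: sum_distrib_right)
qed

lemma tame_gavg [intro, simp]: "tame (bonds N) (gavg N \<beta> u)"
proof (rule tameI)
  have "hamiltonian N (restrict g (bonds N)) = hamiltonian N g" for g
    by (simp add: hamiltonian_def fun_eq_iff bonds_def)
  then show "gavg N \<beta> u (restrict g (bonds N)) = gavg N \<beta> u g" for g
    by (simp add: gavg_def gibbs_weight_def partition_function_def)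
  show "gavg N \<beta> u \<in> borel_measurable (PiM (bonds N) (\<lambda>_. borel))"
    unfolding gavg_def
    by (intro borel_measurable_sum borel_measurable_times borel_measurable_const borel_measurable_gibbs_weight)
       (auto simp: bonds_def)
  show "\<bar>gavg N \<beta> u g\<bar> \<le> Max ((\<lambda>\<sigma>. \<bar>u \<sigma>\<bar>) ` spin_configs N)" for g
    by (rule gavg_abs_le) auto
qed

lemma spin_abs: "\<sigma> \<in> spin_configs N \<Longrightarrow> i \<in> {1..N} \<Longrightarrow> \<bar>\<sigma> i\<bar> = 1"
  using PiE_mem[of \<sigma> "{1..N}" "\<lambda>_. {-1, 1}" i] by (auto simp: spin_configs_def)

definition bond_spin :: "nat \<times> nat \<Rightarrow> (nat \<Rightarrow> real) \<Rightarrow> real" where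
  "bond_spin e \<sigma> = \<sigma> (fst e) * \<sigma> (snd e)"

definition coupling_scale :: "nat \<Rightarrow> real \<Rightarrow> real" where
  "coupling_scale N \<beta> = \<beta> / sqrt (2 * real N)"

lemma hamiltonian_bonds:
  "- \<beta> * hamiltonian N w \<sigma> = (\<Sum>e\<in>bonds N. w e * (coupling_scale N \<beta> * bond_spin e \<sigma>))"
  by (simp add: hamiltonian_def coupling_scale_def bond_spin_def bonds_def sum.cartesian_product case_prod_beta
      sum_distrib_left sum_divide_distrib ac_simps)

lemma hamiltonian_affine:
  "hamiltonian N (\<lambda>e. x e + \<tau> * w e) \<sigma> = hamiltonian N x \<sigma> + \<tau> * hamiltonian N w \<sigma>"
  by (simp add: hamiltonian_def sum.distrib sum_distrib_left algebra_simps)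

text \<open>The Hamiltonian is linear in the couplings, so along a line the Boltzmann factors are
  exponentials of affine functions of \<tau>, and the quotient rule yields a Gibbs
  covariance.\<close>

lemma gavg_has_derivative:
  "((\<lambda>\<tau>. gavg N \<beta> u (\<lambda>e. x e + \<tau> * w e)) has_real_derivative
      gavg N \<beta> (\<lambda>\<sigma>. u \<sigma> * (- \<beta> * hamiltonian N w \<sigma>)) (\<lambda>e. x e + \<tau> * w e) -
      gavg N \<beta> u (\<lambda>e. x e + \<tau> * w e) * gavg N \<beta> (\<lambda>\<sigma>. - \<beta> * hamiltonian N w \<sigma>) (\<lambda>e. x e + \<tau> * w e))
    (at \<tau>)"
proof -
  define l where "l = (\<lambda>\<sigma>. - \<beta> * hamiltonian N w \<sigma>)"
  define B where "B = (\<lambda>\<tau> \<sigma>. exp (- \<beta> * hamiltonian N x \<sigma> + \<tau> * l \<sigma>))"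
  define A where "A = (\<lambda>v \<tau>. \<Sum>\<sigma>\<in>spin_configs N. B \<tau> \<sigma> * v \<sigma>)"
  define Z where "Z = (\<lambda>\<tau>. \<Sum>\<sigma>\<in>spin_configs N. B \<tau> \<sigma>)"
  have B: "exp (- (\<beta> * hamiltonian N (\<lambda>e. x e + \<tau> * w e) \<sigma>)) = B \<tau> \<sigma>" for \<tau> \<sigma>
    by (simp add: B_def l_def hamiltonian_affine algebra_simps)
  have Z: "partition_function N \<beta> (\<lambda>e. x e + \<tau> * w e) = Z \<tau>" for \<tau>
    by (simp add: partition_function_def B Z_def)
  have Zpos: "Z \<tau> > 0" for \<tau>
    using partition_function_pos Z by metis
  have gavg: "gavg N \<beta> v (\<lambda>e. x e + \<tau> * w e) = A v \<tau> / Z \<tau>" for v \<tau>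
    unfolding gavg_def A_def sum_divide_distrib
    by (intro sum.cong refl) (simp add: gibbs_weight_def B Z)
  have l': "- \<beta> * hamiltonian N w \<sigma> = l \<sigma>" for \<sigma>
    by (simp add: l_def)
  have dB: "((\<lambda>\<tau>. B \<tau> \<sigma>) has_real_derivative B \<tau> \<sigma> * l \<sigma>) (at \<tau>)" for \<sigma>
    unfolding B_def by (auto intro!: derivative_eq_intros)
  have "(A u has_real_derivative A (\<lambda>\<sigma>. u \<sigma> * l \<sigma>) \<tau>) (at \<tau>)"
    unfolding A_def
  proof (rule DERIV_sum)
    fix \<sigma>
    show "((\<lambda>\<tau>. B \<tau> \<sigma> * u \<sigma>) has_real_derivative B \<tau> \<sigma> * (u \<sigma> * l \<sigma>)) (at \<tau>)"
      using DERIV_cmult_right[OF dB, of \<sigma> "u \<sigma>"] by (simp add: ac_simps)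
  qed
  moreover have "(Z has_real_derivative A l \<tau>) (at \<tau>)"
    unfolding A_def Z_def by (intro DERIV_sum dB)
  ultimately have "((\<lambda>\<tau>. A u \<tau> / Z \<tau>) has_real_derivative
      (A (\<lambda>\<sigma>. u \<sigma> * l \<sigma>) \<tau> * Z \<tau> - A u \<tau> * A l \<tau>) / (Z \<tau> * Z \<tau>)) (at \<tau>)"
    using Zpos[of \<tau>] by (intro DERIV_divide) auto
  moreover have "(A (\<lambda>\<sigma>. u \<sigma> * l \<sigma>) \<tau> * Z \<tau> - A u \<tau> * A l \<tau>) / (Z \<tau> * Z \<tau>) =
      A (\<lambda>\<sigma>. u \<sigma> * l \<sigma>) \<tau> / Z \<tau> - A u \<tau> / Z \<tau> * (A l \<tau> / Z \<tau>)"
    using Zpos[of \<tau>] by (simp add: diff_divide_distrib)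
  ultimately show ?thesis
    unfolding l' gavg by simp
qed

lemma gavg_cong:
  "(\<And>\<sigma>. \<sigma> \<in> spin_configs N \<Longrightarrow> u \<sigma> = v \<sigma>) \<Longrightarrow> gavg N \<beta> u g = gavg N \<beta> v g"
  by (simp add: gavg_def)

lemma gavg_linear:
  "gavg N \<beta> (\<lambda>\<sigma>. \<Sum>i\<in>I. r i * u i \<sigma>) g = (\<Sum>i\<in>I. r i * gavg N \<beta> (u i) g)"
  unfolding gavg_def sum_distrib_left by (subst sum.swap) (simp add: ac_simps)

text \<open>The partial derivative of the Gibbs average in the coupling \<open>e\<close>, written
  out as a Gibbs covariance. Its role as a derivative is certified by
  \<open>taylor2_gavg\<close>.\<close>

definition dgavg :: "nat \<Rightarrow> real \<Rightarrow> ((nat \<Rightarrow> real) \<Rightarrow> real) \<Rightarrow> nat \<times> nat \<Rightarrow> (nat \<times> nat \<Rightarrow> real) \<Rightarrow> real" where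
  "dgavg N \<beta> u e g = coupling_scale N \<beta> *
     (gavg N \<beta> (\<lambda>\<sigma>. u \<sigma> * bond_spin e \<sigma>) g - gavg N \<beta> u g * gavg N \<beta> (bond_spin e) g)"

lemma bond_spin_abs: "\<sigma> \<in> spin_configs N \<Longrightarrow> e \<in> bonds N \<Longrightarrow> \<bar>bond_spin e \<sigma>\<bar> = 1"
  unfolding bond_spin_def abs_mult bonds_def
  using spin_abs[of \<sigma> N "fst e"] spin_abs[of \<sigma> N "snd e"] by (auto simp: mem_Times_iff)

text \<open>Taylor's formula along the line from x to x + w. A covariance of observables bounded by
  1 is at most 2, which gives the first constant; the second derivative is a joint cumulant of u, l,
  l bounded by 6 m^2, and half of it gives the factor 3.\<close>

lemma taylor2_gavg:
  assumes u: "\<And>\<sigma>. \<sigma> \<in> spin_configs N \<Longrightarrow> \<bar>u \<sigma>\<bar> \<le> 1" and \<beta>: "\<beta> \<ge> 0"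
  shows "taylor2 (bonds N) (gavg N \<beta> u) (dgavg N \<beta> u) (2 * coupling_scale N \<beta>) (3 * (coupling_scale N \<beta>)\<^sup>2)"
  unfolding taylor2_def
proof (intro conjI ballI allI)
  let ?s = "coupling_scale N \<beta>"
  have s: "?s \<ge> 0" using \<beta> by (simp add: coupling_scale_def)
  show "tame (bonds N) (gavg N \<beta> u)" by simp
  fix e assume e: "e \<in> bonds N"
  show "tame (bonds N) (dgavg N \<beta> u e)"
    unfolding dgavg_def by (intro tame_mult tame_const tame_diff tame_gavg)
  fix x
  have "\<bar>gavg N \<beta> (\<lambda>\<sigma>. u \<sigma> * bond_spin e \<sigma>) x\<bar> \<le> 1"
    using u bond_spin_abs[OF _ e] by (intro gavg_abs_le) (simp add: abs_mult)
  moreover have "\<bar>gavg N \<beta> u x * gavg N \<beta> (bond_spin e) x\<bar> \<le> 1"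
    unfolding abs_mult using u bond_spin_abs[OF _ e]
    by (intro mult_le_one gavg_abs_le) auto
  ultimately have "\<bar>gavg N \<beta> (\<lambda>\<sigma>. u \<sigma> * bond_spin e \<sigma>) x - gavg N \<beta> u x * gavg N \<beta> (bond_spin e) x\<bar> \<le> 2"
    by linarith
  then show "\<bar>dgavg N \<beta> u e x\<bar> \<le> 2 * ?s"
    unfolding dgavg_def abs_mult mult.commute[of 2] using s by (intro mult_mono) auto
next
  let ?s = "coupling_scale N \<beta>"
  have s: "?s \<ge> 0" using \<beta> by (simp add: coupling_scale_def)
  fix x w
  define l where "l = (\<lambda>\<sigma>. - \<beta> * hamiltonian N w \<sigma>)"
  define m where "m = ?s * norm1 (bonds N) w"
  have m: "m \<ge> 0" using s by (simp add: m_def norm1_nonneg)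
  have l: "\<bar>l \<sigma>\<bar> \<le> m" if "\<sigma> \<in> spin_configs N" for \<sigma>
  proof -
    have "\<bar>l \<sigma>\<bar> \<le> (\<Sum>e\<in>bonds N. \<bar>w e * (?s * bond_spin e \<sigma>)\<bar>)"
      unfolding l_def hamiltonian_bonds by (rule sum_abs)
    also have "\<dots> = m"
      unfolding m_def norm1_def sum_distrib_left using s bond_spin_abs[OF that]
      by (intro sum.cong refl) (simp add: abs_mult ac_simps)
    finally show ?thesis .
  qed
  \<comment> \<open>\<open>F1\<close> and \<open>F2\<close> are the first and second derivative of
    \<open>G u\<close>; expanded, \<open>F2\<close> is the third-order cumulant <u l l> - 2 <u l>
    <l> - <u> <l l> + 2 <u> <l>^2.\<close>
  define G where "G = (\<lambda>v \<tau>. gavg N \<beta> v (\<lambda>e. x e + \<tau> * w e))"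
  define ul where "ul = (\<lambda>\<sigma>. u \<sigma> * l \<sigma>)"
  define F1 where "F1 = (\<lambda>\<tau>. G ul \<tau> - G u \<tau> * G l \<tau>)"
  define F2 where "F2 = (\<lambda>\<tau>. (G (\<lambda>\<sigma>. ul \<sigma> * l \<sigma>) \<tau> - G ul \<tau> * G l \<tau>) -
    (F1 \<tau> * G l \<tau> + (G (\<lambda>\<sigma>. l \<sigma> * l \<sigma>) \<tau> - G l \<tau> * G l \<tau>) * G u \<tau>))"
  have dG: "(G v has_real_derivative G (\<lambda>\<sigma>. v \<sigma> * l \<sigma>) \<tau> - G v \<tau> * G l \<tau>) (at \<tau>)" for v \<tau>
    unfolding G_def l_def by (rule gavg_has_derivative)
  have d1: "(G u has_real_derivative F1 \<tau>) (at \<tau>)" for \<tau>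
    unfolding F1_def ul_def by (rule dG)
  have d2: "(F1 has_real_derivative F2 \<tau>) (at \<tau>)" for \<tau>
    unfolding F1_def[abs_def] F2_def
    using DERIV_diff[OF dG[of ul \<tau>] DERIV_mult[OF dG[of u \<tau>] dG[of l \<tau>]]]
    by (simp add: F1_def ul_def[abs_def])
  define diff where "diff = (\<lambda>n :: nat. if n = 0 then G u else if n = 1 then F1 else F2)"
  have "\<exists>t>0. t < 1 \<and> G u 1 = (\<Sum>n<2. diff n 0 / fact n * 1 ^ n) + diff 2 t / fact 2 * 1\<^sup>2"
  proof (rule Maclaurin)
    show "\<forall>n t. n < 2 \<and> 0 \<le> t \<and> t \<le> 1 \<longrightarrow> (diff n has_real_derivative diff (Suc n) t) (at t)"
      using d1 d2 by (auto simp: diff_def less_2_cases_iff)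
  qed (auto simp: diff_def)
  then obtain t where t: "G u 1 = G u 0 + F1 0 + F2 t / 2"
    by (auto simp: diff_def numeral_2_eq_2)
  have Gb: "\<bar>G v t\<bar> \<le> B" if "\<And>\<sigma>. \<sigma> \<in> spin_configs N \<Longrightarrow> \<bar>v \<sigma>\<bar> \<le> B" for v B
    unfolding G_def using that by (rule gavg_abs_le)
  have ul_le: "\<bar>ul \<sigma>\<bar> \<le> m" if "\<sigma> \<in> spin_configs N" for \<sigma>
    unfolding ul_def abs_mult using mult_mono[OF u[OF that] l[OF that]] by simp
  have Gu: "\<bar>G u t\<bar> \<le> 1" and Gl: "\<bar>G l t\<bar> \<le> m" and Gul: "\<bar>G ul t\<bar> \<le> m"
    using Gb u l ul_le by auto
  have Gull: "\<bar>G (\<lambda>\<sigma>. ul \<sigma> * l \<sigma>) t\<bar> \<le> m * m" and Gll: "\<bar>G (\<lambda>\<sigma>. l \<sigma> * l \<sigma>) t\<bar> \<le> m * m"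
    using mult_mono[OF ul_le l] mult_mono[OF l l] m
    by (auto intro!: Gb simp: abs_mult simp del: abs_mult_self_eq)
  have "\<bar>G ul t * G l t\<bar> \<le> m * m" "\<bar>G l t * G l t\<bar> \<le> m * m" "\<bar>G u t * G l t\<bar> \<le> 1 * m"
    unfolding abs_mult using Gu Gl Gul m by (intro mult_mono; simp)+
  then have bF1: "\<bar>F1 t\<bar> \<le> 2 * m" and b1: "\<bar>G ul t * G l t\<bar> \<le> m * m"
    and b2: "\<bar>G (\<lambda>\<sigma>. l \<sigma> * l \<sigma>) t - G l t * G l t\<bar> \<le> 2 * (m * m)"
    using Gul Gll unfolding F1_def by linarith+
  have "\<bar>F1 t * G l t\<bar> \<le> 2 * m * m"
    unfolding abs_mult using bF1 Gl m by (intro mult_mono) auto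
  moreover have "\<bar>(G (\<lambda>\<sigma>. l \<sigma> * l \<sigma>) t - G l t * G l t) * G u t\<bar> \<le> 2 * (m * m) * 1"
    unfolding abs_mult using b2 Gu m by (intro mult_mono) auto
  ultimately have "\<bar>F2 t\<bar> \<le> 6 * (m * m)"
    unfolding F2_def using Gull b1 by (simp only: mult.assoc mult_1_right)
  then have *: "\<bar>G u 1 - G u 0 - F1 0\<bar> \<le> 3 * (m * m)"
    unfolding t by simp
  have "F1 0 = (\<Sum>e\<in>bonds N. w e * dgavg N \<beta> u e x)"
  proof -
    have "G ul 0 = gavg N \<beta> (\<lambda>\<sigma>. \<Sum>e\<in>bonds N. (w e * ?s) * (u \<sigma> * bond_spin e \<sigma>)) x"
      unfolding G_def ul_def l_def hamiltonian_bonds by (simp add: sum_distrib_left ac_simps)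
    moreover have "G l 0 = gavg N \<beta> (\<lambda>\<sigma>. \<Sum>e\<in>bonds N. (w e * ?s) * bond_spin e \<sigma>) x"
      unfolding G_def l_def hamiltonian_bonds by (simp add: ac_simps)
    moreover have "G u 0 = gavg N \<beta> u x" by (simp add: G_def)
    ultimately show ?thesis
      unfolding F1_def gavg_linear dgavg_def
      by (simp add: sum_distrib_left sum_subtractf algebra_simps)
  qed
  then show "\<bar>gavg N \<beta> u (\<lambda>e. x e + w e) - gavg N \<beta> u x - (\<Sum>e\<in>bonds N. w e * dgavg N \<beta> u e x)\<bar>
      \<le> 3 * ?s\<^sup>2 * (norm1 (bonds N) w)\<^sup>2"
    using * by (simp add: G_def m_def power2_eq_square ac_simps)
qed

text \<open>Ordered lists of sites with repetitions allowed: expanding a power of a sum over sites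
  then meets every word exactly once, without multinomial coefficients.\<close>

definition words :: "nat \<Rightarrow> nat \<Rightarrow> nat list set" where
  "words N m = {xs. set xs \<subseteq> {1..N} \<and> length xs = m}"

definition monomial :: "nat list \<Rightarrow> (nat \<Rightarrow> real) \<Rightarrow> real" where
  "monomial xs \<sigma> = (\<Prod>i\<leftarrow>xs. \<sigma> i)"

lemma finite_words [simp]: "finite (words N m)"
  unfolding words_def by (rule finite_lists_length_eq) simp

lemma card_words: "card (words N m) = N ^ m"
  unfolding words_def by (subst card_lists_length_eq) auto

lemma sum_words_Suc: "(\<Sum>xs\<in>words N (Suc m). f xs) = (\<Sum>i\<in>{1..N}. \<Sum>xs\<in>words N m. f (i # xs))"
proof -
  have "(\<Sum>i\<in>{1..N}. \<Sum>xs\<in>words N m. f (i # xs)) = (\<Sum>p\<in>{1..N} \<times> words N m. f (fst p # snd p))"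
    by (simp add: sum.cartesian_product case_prod_beta)
  also have "\<dots> = (\<Sum>xs\<in>words N (Suc m). f xs)"
    by (rule sum.reindex_bij_witness[of _ "\<lambda>xs. (hd xs, tl xs)" "\<lambda>p. fst p # snd p"])
       (auto simp: words_def length_Suc_conv)
  finally show ?thesis by simp
qed

lemma sum_words_0 [simp]: "(\<Sum>xs\<in>words N 0. f xs) = f []"
proof -
  have "words N 0 = {[]}" by (auto simp: words_def)
  then show ?thesis by simp
qed

text \<open>This puts powers of the overlap into Gram form, a sum of products of one function at
  \<sigma> and at \<tau>. That form is what allows the two replicas to be averaged
  separately.\<close>

lemma sum_monomial: "(\<Sum>xs\<in>words N m. monomial xs \<sigma> * monomial xs \<tau>) = (\<Sum>i\<in>{1..N}. \<sigma> i * \<tau> i) ^ m"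
proof (induction m)
  case 0
  then show ?case by (simp add: monomial_def)
next
  case (Suc m)
  have "(\<Sum>xs\<in>words N (Suc m). monomial xs \<sigma> * monomial xs \<tau>) =
      (\<Sum>i\<in>{1..N}. \<Sum>xs\<in>words N m. (\<sigma> i * \<tau> i) * (monomial xs \<sigma> * monomial xs \<tau>))"
    unfolding sum_words_Suc by (intro sum.cong refl) (simp add: monomial_def)
  also have "\<dots> = (\<Sum>i\<in>{1..N}. \<sigma> i * \<tau> i) * (\<Sum>i\<in>{1..N}. \<sigma> i * \<tau> i) ^ m"
    by (simp add: Suc.IH sum_distrib_right flip: sum_distrib_left)
  finally show ?case by simp
qed

lemma monomial_abs:
  assumes "\<sigma> \<in> spin_configs N" "xs \<in> words N m" shows "\<bar>monomial xs \<sigma>\<bar> = 1"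
proof -
  have "set xs \<subseteq> {1..N} \<Longrightarrow> \<bar>monomial xs \<sigma>\<bar> = 1"
    by (induction xs) (use spin_abs[OF assms(1)] in \<open>auto simp: monomial_def abs_mult\<close>)
  then show ?thesis using assms(2) by (simp add: words_def)
qed

text \<open>The average over two independent replicas, each with its own disorder.\<close>

definition pair_gavg ::
    "nat \<Rightarrow> real \<Rightarrow> ((nat \<Rightarrow> real) \<Rightarrow> (nat \<Rightarrow> real) \<Rightarrow> real) \<Rightarrow>
      (nat \<times> nat \<Rightarrow> real) \<Rightarrow> (nat \<times> nat \<Rightarrow> real) \<Rightarrow> real" where
  "pair_gavg N \<beta> u g g' = gavg N \<beta> (\<lambda>\<sigma>. gavg N \<beta> (u \<sigma>) g') g"

lemma pair_gavg_alt:
  "pair_gavg N \<beta> u g g' = (\<Sum>p\<in>spin_configs N \<times> spin_configs N.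
     gibbs_weight N \<beta> g (fst p) * gibbs_weight N \<beta> g' (snd p) * u (fst p) (snd p))"
  by (simp add: pair_gavg_def gavg_def sum.cartesian_product case_prod_beta sum_distrib_left mult.assoc)

lemma pair_gavg_sum_product:
  "(\<Sum>i\<in>I. gavg N \<beta> (v i) g * gavg N \<beta> (v i) g') = pair_gavg N \<beta> (\<lambda>\<sigma> \<tau>. \<Sum>i\<in>I. v i \<sigma> * v i \<tau>) g g'"
proof -
  have "pair_gavg N \<beta> (\<lambda>\<sigma> \<tau>. \<Sum>i\<in>I. v i \<sigma> * v i \<tau>) g g' =
      gavg N \<beta> (\<lambda>\<sigma>. \<Sum>i\<in>I. v i \<sigma> * gavg N \<beta> (v i) g') g"
    unfolding pair_gavg_def gavg_linear ..
  also have "\<dots> = gavg N \<beta> (\<lambda>\<sigma>. \<Sum>i\<in>I. gavg N \<beta> (v i) g' * v i \<sigma>) g"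
    by (intro gavg_cong sum.cong refl mult.commute)
  also have "\<dots> = (\<Sum>i\<in>I. gavg N \<beta> (v i) g * gavg N \<beta> (v i) g')"
    unfolding gavg_linear by (simp add: mult.commute)
  finally show ?thesis by simp
qed

text \<open>Chebyshev's association inequality: X^k and X are increasing functions of the same
  nonnegative quantity, so each term of the symmetrised double sum over two independent copies is
  nonnegative.\<close>

lemma chebyshev_power:
  fixes X p :: "'a \<Rightarrow> real"
  assumes D: "finite D" "(\<Sum>a\<in>D. p a) = 1" "\<And>a. a \<in> D \<Longrightarrow> p a \<ge> 0" "\<And>a. a \<in> D \<Longrightarrow> X a \<ge> 0"
  shows "(\<Sum>a\<in>D. p a * X a ^ k) * (\<Sum>a\<in>D. p a * X a) \<le> (\<Sum>a\<in>D. p a * X a ^ Suc k)"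
proof -
  have "0 \<le> (\<Sum>a\<in>D. \<Sum>b\<in>D. p a * p b * ((X a ^ k - X b ^ k) * (X a - X b)))"
  proof (intro sum_nonneg)
    fix a b assume ab: "a \<in> D" "b \<in> D"
    have "0 \<le> (X a ^ k - X b ^ k) * (X a - X b)"
      using power_mono[of "X a" "X b" k] power_mono[of "X b" "X a" k] D(4) ab
      by (cases "X a \<le> X b") (auto intro!: mult_nonneg_nonneg mult_nonpos_nonpos)
    then show "0 \<le> p a * p b * ((X a ^ k - X b ^ k) * (X a - X b))"
      by (rule mult_nonneg_nonneg[rotated]) (use D(3) ab in simp)
  qed
  also have "\<dots> = (\<Sum>a\<in>D. \<Sum>b\<in>D. p b * (p a * X a ^ Suc k)) + (\<Sum>a\<in>D. \<Sum>b\<in>D. p a * (p b * X b ^ Suc k))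
      - (\<Sum>a\<in>D. \<Sum>b\<in>D. (p a * X a ^ k) * (p b * X b)) - (\<Sum>a\<in>D. \<Sum>b\<in>D. (p a * X a) * (p b * X b ^ k))"
    unfolding sum_subtractf[symmetric] sum.distrib[symmetric]
    by (intro sum.cong refl) (simp add: algebra_simps)
  also have "\<dots> = 2 * (\<Sum>a\<in>D. p a * X a ^ Suc k) - 2 * ((\<Sum>a\<in>D. p a * X a ^ k) * (\<Sum>a\<in>D. p a * X a))"
  proof -
    have "(\<Sum>a\<in>D. \<Sum>b\<in>D. p b * (p a * X a ^ Suc k)) = (\<Sum>a\<in>D. p a * X a ^ Suc k)"
      "(\<Sum>a\<in>D. \<Sum>b\<in>D. p a * (p b * X b ^ Suc k)) = (\<Sum>a\<in>D. p a * X a ^ Suc k)"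
      using D(2) by (simp_all flip: sum_distrib_left sum_distrib_right)
    moreover have "(\<Sum>a\<in>D. \<Sum>b\<in>D. (p a * X a ^ k) * (p b * X b)) = (\<Sum>a\<in>D. p a * X a ^ k) * (\<Sum>a\<in>D. p a * X a)"
      "(\<Sum>a\<in>D. \<Sum>b\<in>D. (p a * X a) * (p b * X b ^ k)) = (\<Sum>a\<in>D. p a * X a ^ k) * (\<Sum>a\<in>D. p a * X a)"
      unfolding sum_product[symmetric] by (simp_all add: mult.commute)
    ultimately show ?thesis by linarith
  qed
  finally show ?thesis by simp
qed

section \<open>The hierarchy of overlap moments\<close>

text \<open>N^(2k) times the conditional expectation of R^(2k) when the common part of both
  disorders is \<open>x\<close> and each replica has independent private noise of variance
  \<open>c\<close>. The squares arise because, given \<open>x\<close>, the two replicas are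
  independent and identically distributed.\<close>

definition smoothed_overlap :: "nat \<Rightarrow> real \<Rightarrow> nat \<Rightarrow> real \<Rightarrow> (nat \<times> nat \<Rightarrow> real) \<Rightarrow> real" where
  "smoothed_overlap N \<beta> k c x =
     (\<Sum>xs\<in>words N (2 * k). (gconv (bonds N) c (gavg N \<beta> (monomial xs)) x)\<^sup>2)"

text \<open>Here \<open>a\<close> is the variance of the noise common to the two replicas and \<open>c\<close> that of the
  noise private to each; perturbed couplings correspond to \<open>a = exp (- t)\<close> and \<open>c = 1 - a\<close>.\<close>

definition overlap_moment :: "nat \<Rightarrow> real \<Rightarrow> nat \<Rightarrow> real \<Rightarrow> real \<Rightarrow> real" where
  "overlap_moment N \<beta> k a c =
     gconv (bonds N) a (smoothed_overlap N \<beta> k c) (\<lambda>_. 0) / real N ^ (2 * k)"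

lemma tame_smoothed_overlap [intro, simp]: "tame (bonds N) (smoothed_overlap N \<beta> k c)"
  unfolding smoothed_overlap_def by (intro tame_sum tame_power tame_gconv tame_gavg)

lemma overlap_moment_nonneg: "overlap_moment N \<beta> k a c \<ge> 0"
  unfolding overlap_moment_def smoothed_overlap_def
  by (intro divide_nonneg_nonneg gconv_nonneg sum_nonneg) auto

lemma gconv_kernel:
  assumes "\<And>i. i \<in> I \<Longrightarrow> tame E (F i)"
  shows "gconv E c (\<lambda>g'. \<Sum>i\<in>I. F i g * F i g') x = (\<Sum>i\<in>I. gconv E c (F i) x * F i g)"
    and "gconv E c (\<lambda>g. \<Sum>i\<in>I. gconv E c (F i) x * F i g) x = (\<Sum>i\<in>I. (gconv E c (F i) x)\<^sup>2)"
  using assms by (simp_all add: gconv_sum tame_mult gconv_cmult power2_eq_square)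
    (simp add: mult.commute)

text \<open>A sum of squared convolutions is the kernel averaged over two independent noises, one in
  \<open>g\<close> and one in \<open>g'\<close>. A comparison of kernels at every pair of disorders
  therefore passes to the sums of squares; the averaging is done in one variable at a time.\<close>

lemma gconv_kernel_mono:
  assumes F: "\<And>i. i \<in> I \<Longrightarrow> tame E (F i)" and G: "\<And>j. j \<in> J \<Longrightarrow> tame E (G j)"
    and le: "\<And>g g'. (\<Sum>i\<in>I. F i g * F i g') \<le> (\<Sum>j\<in>J. G j g * G j g')"
  shows "(\<Sum>i\<in>I. (gconv E c (F i) x)\<^sup>2) \<le> (\<Sum>j\<in>J. (gconv E c (G j) x)\<^sup>2)"
proof -
  have F1: "gconv E c (\<lambda>g'. \<Sum>i\<in>I. F i g * F i g') x = (\<Sum>i\<in>I. gconv E c (F i) x * F i g)"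
    and F2: "gconv E c (\<lambda>g. \<Sum>i\<in>I. gconv E c (F i) x * F i g) x = (\<Sum>i\<in>I. (gconv E c (F i) x)\<^sup>2)" for g
    by (rule gconv_kernel; rule F; assumption)+
  have G1: "gconv E c (\<lambda>g'. \<Sum>j\<in>J. G j g * G j g') x = (\<Sum>j\<in>J. gconv E c (G j) x * G j g)"
    and G2: "gconv E c (\<lambda>g. \<Sum>j\<in>J. gconv E c (G j) x * G j g) x = (\<Sum>j\<in>J. (gconv E c (G j) x)\<^sup>2)" for g
    by (rule gconv_kernel; rule G; assumption)+
  have "(\<Sum>i\<in>I. gconv E c (F i) x * F i g) \<le> (\<Sum>j\<in>J. gconv E c (G j) x * G j g)" for g
    unfolding F1[symmetric] G1[symmetric]
    by (intro gconv_mono tame_sum tame_mult tame_const F G le)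
  then show ?thesis
    unfolding F2[symmetric] G2[symmetric]
    by (intro gconv_mono tame_sum tame_mult tame_const F G)
qed

text \<open>The reason why the gradient in the couplings leads from moment k to moment k+1: the
  bonds contribute exactly one more squared overlap.\<close>

lemma sum_bond_spin:
  "(\<Sum>e\<in>bonds N. bond_spin e \<sigma> * bond_spin e \<tau>) = (\<Sum>i\<in>{1..N}. \<sigma> i * \<tau> i)\<^sup>2"
  by (simp add: bonds_def bond_spin_def power2_eq_square sum_product sum.cartesian_product
      case_prod_beta ac_simps)

lemma sum_monomial_even:
  "(\<Sum>xs\<in>words N (2 * k). monomial xs \<sigma> * monomial xs \<tau>) = ((\<Sum>i\<in>{1..N}. \<sigma> i * \<tau> i)\<^sup>2) ^ k"
  by (simp add: sum_monomial power_mult)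

text \<open>The covariance splits into a joint part \<open>A\<close> and a product part
  \<open>B\<close>. With X the squared unnormalised overlap, the kernel of \<open>A\<close> is the
  replica average of X^(k+1), while that of \<open>B\<close> is the average of X^k times the average
  of X, which is no larger by association. The factor 4 comes from (u - v)^2 \<le> 2 (u^2 + v^2)
  applied to two terms with the same bound.\<close>

lemma sum_dgavg_le:
  assumes \<beta>: "\<beta> \<ge> 0"
  shows "(\<Sum>xs\<in>words N (2 * k). \<Sum>e\<in>bonds N. (gconv (bonds N) c (dgavg N \<beta> (monomial xs) e) x)\<^sup>2)
    \<le> 4 * (coupling_scale N \<beta>)\<^sup>2 * smoothed_overlap N \<beta> (Suc k) c x"
proof -
  let ?s = "coupling_scale N \<beta>" and ?P = "gconv (bonds N) c"
  define A where "A = (\<lambda>p :: nat list \<times> nat \<times> nat. gavg N \<beta> (\<lambda>\<sigma>. monomial (fst p) \<sigma> * bond_spin (snd p) \<sigma>))"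
  define B where "B = (\<lambda>p :: nat list \<times> nat \<times> nat. \<lambda>g. gavg N \<beta> (monomial (fst p)) g * gavg N \<beta> (bond_spin (snd p)) g)"
  define W where "W = words N (2 * k) \<times> bonds N"
  define X where "X = (\<lambda>\<sigma> \<tau> :: nat \<Rightarrow> real. (\<Sum>i\<in>{1..N}. \<sigma> i * \<tau> i)\<^sup>2)"
  have tA: "tame (bonds N) (A p)" and tB: "tame (bonds N) (B p)" for p
    unfolding A_def B_def by (auto intro: tame_mult)
  have top: "(\<Sum>ys\<in>words N (2 * Suc k). gavg N \<beta> (monomial ys) g * gavg N \<beta> (monomial ys) g') =
      pair_gavg N \<beta> (\<lambda>\<sigma> \<tau>. X \<sigma> \<tau> ^ Suc k) g g'" for g g'
    unfolding pair_gavg_sum_product sum_monomial_even X_def ..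
  have "(\<Sum>p\<in>W. (?P (A p) x)\<^sup>2) \<le> smoothed_overlap N \<beta> (Suc k) c x"
    unfolding smoothed_overlap_def
  proof (rule gconv_kernel_mono[OF tA tame_gavg])
    fix g g'
    have "(\<Sum>p\<in>W. A p g * A p g') = pair_gavg N \<beta>
        (\<lambda>\<sigma> \<tau>. \<Sum>p\<in>W. (monomial (fst p) \<sigma> * bond_spin (snd p) \<sigma>) * (monomial (fst p) \<tau> * bond_spin (snd p) \<tau>)) g g'"
      unfolding A_def pair_gavg_sum_product ..
    also have "(\<lambda>\<sigma> \<tau>. \<Sum>p\<in>W. (monomial (fst p) \<sigma> * bond_spin (snd p) \<sigma>) * (monomial (fst p) \<tau> * bond_spin (snd p) \<tau>)) =
        (\<lambda>\<sigma> \<tau>. X \<sigma> \<tau> ^ Suc k)"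
    proof (intro ext)
      fix \<sigma> \<tau> :: "nat \<Rightarrow> real"
      have "(\<Sum>p\<in>W. (monomial (fst p) \<sigma> * bond_spin (snd p) \<sigma>) * (monomial (fst p) \<tau> * bond_spin (snd p) \<tau>)) =
          (\<Sum>xs\<in>words N (2 * k). monomial xs \<sigma> * monomial xs \<tau>) * (\<Sum>e\<in>bonds N. bond_spin e \<sigma> * bond_spin e \<tau>)"
        unfolding W_def sum_product sum.cartesian_product by (intro sum.cong) auto
      then show "(\<Sum>p\<in>W. (monomial (fst p) \<sigma> * bond_spin (snd p) \<sigma>) * (monomial (fst p) \<tau> * bond_spin (snd p) \<tau>)) =
          X \<sigma> \<tau> ^ Suc k"
        unfolding sum_monomial_even sum_bond_spin X_def by simp
    qed
    finally show "(\<Sum>p\<in>W. A p g * A p g') \<le>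
        (\<Sum>ys\<in>words N (2 * Suc k). gavg N \<beta> (monomial ys) g * gavg N \<beta> (monomial ys) g')"
      unfolding top by simp
  qed
  moreover have "(\<Sum>p\<in>W. (?P (B p) x)\<^sup>2) \<le> smoothed_overlap N \<beta> (Suc k) c x"
    unfolding smoothed_overlap_def
  proof (rule gconv_kernel_mono[OF tB tame_gavg])
    fix g g'
    let ?D = "spin_configs N \<times> spin_configs N"
    let ?p = "\<lambda>q. gibbs_weight N \<beta> g (fst q) * gibbs_weight N \<beta> g' (snd q)"
    have "(\<Sum>p\<in>W. B p g * B p g') =
        (\<Sum>xs\<in>words N (2 * k). gavg N \<beta> (monomial xs) g * gavg N \<beta> (monomial xs) g') *
        (\<Sum>e\<in>bonds N. gavg N \<beta> (bond_spin e) g * gavg N \<beta> (bond_spin e) g')"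
      unfolding W_def B_def sum_product sum.cartesian_product by (intro sum.cong) auto
    also have "\<dots> = pair_gavg N \<beta> (\<lambda>\<sigma> \<tau>. X \<sigma> \<tau> ^ k) g g' * pair_gavg N \<beta> X g g'"
      unfolding pair_gavg_sum_product sum_monomial_even sum_bond_spin X_def ..
    also have "\<dots> \<le> pair_gavg N \<beta> (\<lambda>\<sigma> \<tau>. X \<sigma> \<tau> ^ Suc k) g g'"
      unfolding pair_gavg_alt
    proof (rule chebyshev_power[of ?D ?p "\<lambda>q. X (fst q) (snd q)"])
      show "(\<Sum>q\<in>?D. ?p q) = 1"
        using sum_product[of "gibbs_weight N \<beta> g" "spin_configs N" "gibbs_weight N \<beta> g'" "spin_configs N"]
        by (simp add: sum_gibbs_weight sum.cartesian_product case_prod_beta)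
    qed (auto simp: X_def gibbs_weight_nonneg)
    finally show "(\<Sum>p\<in>W. B p g * B p g') \<le>
        (\<Sum>ys\<in>words N (2 * Suc k). gavg N \<beta> (monomial ys) g * gavg N \<beta> (monomial ys) g')"
      unfolding top .
  qed
  moreover have "(\<Sum>xs\<in>words N (2 * k). \<Sum>e\<in>bonds N. (?P (dgavg N \<beta> (monomial xs) e) x)\<^sup>2) \<le>
      2 * ?s\<^sup>2 * ((\<Sum>p\<in>W. (?P (A p) x)\<^sup>2) + (\<Sum>p\<in>W. (?P (B p) x)\<^sup>2))"
  proof -
    have "(?P (dgavg N \<beta> (monomial xs) e) x)\<^sup>2 \<le>
        2 * ?s\<^sup>2 * ((?P (A (xs, e)) x)\<^sup>2 + (?P (B (xs, e)) x)\<^sup>2)" for xs e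
    proof -
      have "?P (dgavg N \<beta> (monomial xs) e) x = ?s * ?P (\<lambda>g. A (xs, e) g - B (xs, e) g) x"
        unfolding dgavg_def[abs_def] gconv_cmult by (simp add: A_def B_def)
      also have "\<dots> = ?s * (?P (A (xs, e)) x - ?P (B (xs, e)) x)"
        using tA tB by (simp add: gconv_diff)
      finally have "(?P (dgavg N \<beta> (monomial xs) e) x)\<^sup>2 = ?s\<^sup>2 * (?P (A (xs, e)) x - ?P (B (xs, e)) x)\<^sup>2"
        by (simp add: power_mult_distrib)
      also have "\<dots> \<le> ?s\<^sup>2 * (2 * ((?P (A (xs, e)) x)\<^sup>2 + (?P (B (xs, e)) x)\<^sup>2))"
      proof (rule mult_left_mono)
        have "(u - v)\<^sup>2 \<le> 2 * (u\<^sup>2 + v\<^sup>2)" for u v :: real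
          using zero_le_power2[of "u + v"] by (simp add: power2_eq_square algebra_simps)
        then show "(?P (A (xs, e)) x - ?P (B (xs, e)) x)\<^sup>2 \<le> 2 * ((?P (A (xs, e)) x)\<^sup>2 + (?P (B (xs, e)) x)\<^sup>2)" .
      qed simp
      finally show ?thesis by (simp only: mult.assoc mult.left_commute[of 2])
    qed
    then have "(\<Sum>p\<in>W. (?P (dgavg N \<beta> (monomial (fst p)) (snd p)) x)\<^sup>2) \<le>
        (\<Sum>p\<in>W. 2 * ?s\<^sup>2 * ((?P (A p) x)\<^sup>2 + (?P (B p) x)\<^sup>2))"
      by (intro sum_mono) auto
    then show ?thesis
      by (simp add: W_def sum.cartesian_product case_prod_beta sum_distrib_left sum.distrib distrib_left)
  qed
  moreover have "2 * ?s\<^sup>2 * (u + v) \<le> 4 * ?s\<^sup>2 * w" if "u \<le> w" "v \<le> w" for u v w :: real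
    using mult_left_mono[of "u + v" "2 * w" "2 * ?s\<^sup>2"] that by simp
  ultimately show ?thesis by (meson order_trans)
qed

text \<open>The constant of \<open>gconv_near\<close> for \<open>L\<close> and \<open>M\<close> as
  in \<open>taylor2_gavg\<close>; \<open>variance_error\<close> plays the same part for
  \<open>gconv_variance_le\<close>. Both depend on N and \<beta> alone, not on k or on the noise
  levels.\<close>

definition near_error :: "nat \<Rightarrow> real \<Rightarrow> real" where
  "near_error N \<beta> = 2 * coupling_scale N \<beta> * moment1 (bonds N) 1 + 3 * (coupling_scale N \<beta>)\<^sup>2 * moment1 (bonds N) 2"

definition variance_error :: "nat \<Rightarrow> real \<Rightarrow> real" where
  "variance_error N \<beta> = 2 * (2 * coupling_scale N \<beta>) * (3 * (coupling_scale N \<beta>)\<^sup>2) * moment1 (bonds N) 3 +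
     (3 * (coupling_scale N \<beta>)\<^sup>2)\<^sup>2 * moment1 (bonds N) 4"

lemma coupling_scale_nonneg: "\<beta> \<ge> 0 \<Longrightarrow> coupling_scale N \<beta> \<ge> 0"
  by (simp add: coupling_scale_def)

lemma near_error_nonneg: "\<beta> \<ge> 0 \<Longrightarrow> near_error N \<beta> \<ge> 0"
  by (simp add: near_error_def coupling_scale_nonneg moment1_nonneg)

lemma variance_error_nonneg: "\<beta> \<ge> 0 \<Longrightarrow> variance_error N \<beta> \<ge> 0"
  by (simp add: variance_error_def coupling_scale_nonneg moment1_nonneg)

lemma taylor2_smoothed:
  assumes "xs \<in> words N m" "\<beta> \<ge> 0"
  shows "taylor2 (bonds N) (gconv (bonds N) c (gavg N \<beta> (monomial xs)))
    (\<lambda>e. gconv (bonds N) c (dgavg N \<beta> (monomial xs) e))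
    (2 * coupling_scale N \<beta>) (3 * (coupling_scale N \<beta>)\<^sup>2)"
  using assms by (intro taylor2_gconv taylor2_gavg) (auto simp: monomial_abs)

lemma gconv_gavg_abs_le:
  assumes "xs \<in> words N m"
  shows "\<bar>gconv (bonds N) c (gavg N \<beta> (monomial xs)) x\<bar> \<le> 1"
  using assms by (intro gconv_abs_le gavg_abs_le) (auto simp: monomial_abs)

text \<open>Each summand is the square of a number in [-1,1], so a change of that number costs at
  most twice its size. The factor N^(2k) is the number of words.\<close>

lemma smoothed_overlap_near:
  assumes \<beta>: "\<beta> \<ge> 0" and b: "0 \<le> b" "b \<le> 1" and c: "c \<ge> 0"
  shows "smoothed_overlap N \<beta> k c x \<le>
    smoothed_overlap N \<beta> k (b + c) x + real N ^ (2 * k) * (2 * sqrt b * near_error N \<beta>)"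
proof -
  have "smoothed_overlap N \<beta> k c x \<le> (\<Sum>xs\<in>words N (2 * k).
      (gconv (bonds N) (b + c) (gavg N \<beta> (monomial xs)) x)\<^sup>2 + 2 * sqrt b * near_error N \<beta>)"
    unfolding smoothed_overlap_def
  proof (rule sum_mono)
    fix xs assume xs: "xs \<in> words N (2 * k)"
    let ?f = "gavg N \<beta> (monomial xs)"
    define u v where "u = gconv (bonds N) c ?f x" and "v = gconv (bonds N) (b + c) ?f x"
    have "gconv (bonds N) b (gconv (bonds N) c ?f) x = v"
      unfolding v_def using b c by (intro gconv_gconv tame_gavg finite_bonds)
    then have "\<bar>v - u\<bar> \<le> sqrt b * near_error N \<beta>"
      using gconv_near[OF taylor2_smoothed[OF xs \<beta>] finite_bonds b, of c x] \<beta>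
      by (simp add: u_def near_error_def coupling_scale_nonneg)
    moreover have "\<bar>u\<bar> \<le> 1" "\<bar>v\<bar> \<le> 1"
      unfolding u_def v_def using gconv_gavg_abs_le[OF xs] by auto
    moreover have "u\<^sup>2 - v\<^sup>2 \<le> \<bar>v - u\<bar> * \<bar>u + v\<bar>"
    proof -
      have "u\<^sup>2 - v\<^sup>2 = - ((v - u) * (u + v))" by algebra
      also have "\<dots> \<le> \<bar>(v - u) * (u + v)\<bar>" by linarith
      finally show ?thesis by (simp add: abs_mult)
    qed
    moreover have "\<bar>u + v\<bar> \<le> 2" using calculation by linarith
    moreover have "\<bar>v - u\<bar> * \<bar>u + v\<bar> \<le> (sqrt b * near_error N \<beta>) * 2"
      using calculation by (intro mult_mono) auto
    ultimately show "u\<^sup>2 \<le> v\<^sup>2 + 2 * sqrt b * near_error N \<beta>"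
      by simp
  qed
  then show ?thesis
    by (simp add: smoothed_overlap_def sum.distrib card_words)
qed

text \<open>Collects the Poincare error and the cost of adding \<open>b\<close> to the private noise
  in moment k+1. After division by N^(2k) it is free of k, as a hierarchy over all k
  requires.\<close>

definition step_error :: "nat \<Rightarrow> real \<Rightarrow> real" where
  "step_error N \<beta> = variance_error N \<beta> + 4 * \<beta>\<^sup>2 * real N * near_error N \<beta>"

lemma step_error_nonneg: "\<beta> \<ge> 0 \<Longrightarrow> step_error N \<beta> \<ge> 0"
  by (simp add: step_error_def variance_error_nonneg near_error_nonneg)

text \<open>One explicit Euler step: variance \<open>b\<close> passes from private to common while
  the total a + b + c stays fixed. The rate 2 \<beta>^2 N is 4 (from \<open>sum_dgavg_le\<close>)
  times \<beta>^2 / (2 N) times the N^2 by which the normalisations of moments k and k+1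
  differ.\<close>

lemma overlap_moment_step:
  assumes \<beta>: "\<beta> \<ge> 0" and a: "a \<ge> 0" and b: "0 \<le> b" "b \<le> 1" and c: "c \<ge> 0" and N: "N \<ge> 1"
  shows "overlap_moment N \<beta> k (a + b) c \<le> overlap_moment N \<beta> k a (b + c) +
    2 * \<beta>\<^sup>2 * real N * b * overlap_moment N \<beta> (Suc k) a (b + c) + b * sqrt b * step_error N \<beta>"
proof -
  let ?s = "coupling_scale N \<beta>" and ?P = "gconv (bonds N)" and ?S = "smoothed_overlap N \<beta>"
  let ?n = "real N ^ (2 * k)"
  have s2: "4 * ?s\<^sup>2 * (real N)\<^sup>2 = 2 * \<beta>\<^sup>2 * real N"
    using N by (simp add: coupling_scale_def power2_eq_square field_simps)
  have pt: "?P b (?S k c) x \<le> ?S k (b + c) x + b * (4 * ?s\<^sup>2) * ?S (Suc k) (b + c) x +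
      ?n * (b * sqrt b * step_error N \<beta>)" for x
  proof -
    have "?P b (?S k c) x = (\<Sum>xs\<in>words N (2 * k). ?P b (\<lambda>x. (?P c (gavg N \<beta> (monomial xs)) x)\<^sup>2) x)"
      unfolding smoothed_overlap_def[abs_def] by (intro gconv_sum tame_power tame_gconv tame_gavg)
    also have "\<dots> \<le> (\<Sum>xs\<in>words N (2 * k). (?P (b + c) (gavg N \<beta> (monomial xs)) x)\<^sup>2 +
        (b * (\<Sum>e\<in>bonds N. (?P c (dgavg N \<beta> (monomial xs) e) x)\<^sup>2) + b * sqrt b * variance_error N \<beta>))"
    proof (rule sum_mono)
      fix xs assume xs: "xs \<in> words N (2 * k)"
      have "?P b (?P c (gavg N \<beta> (monomial xs))) x = ?P (b + c) (gavg N \<beta> (monomial xs)) x"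
        using b c by (intro gconv_gconv tame_gavg finite_bonds)
      then show "?P b (\<lambda>x. (?P c (gavg N \<beta> (monomial xs)) x)\<^sup>2) x \<le> (?P (b + c) (gavg N \<beta> (monomial xs)) x)\<^sup>2 +
          (b * (\<Sum>e\<in>bonds N. (?P c (dgavg N \<beta> (monomial xs) e) x)\<^sup>2) + b * sqrt b * variance_error N \<beta>)"
        using gconv_variance_le[OF taylor2_smoothed[OF xs \<beta>] finite_bonds b, of c x] \<beta>
        by (simp add: variance_error_def coupling_scale_nonneg)
    qed
    also have "\<dots> = ?S k (b + c) x +
        b * (\<Sum>xs\<in>words N (2 * k). \<Sum>e\<in>bonds N. (?P c (dgavg N \<beta> (monomial xs) e) x)\<^sup>2) +
        ?n * (b * sqrt b * variance_error N \<beta>)"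
      by (simp add: sum.distrib smoothed_overlap_def sum_distrib_left card_words)
    \<comment> \<open>The gradient bound lives at private variance \<open>c\<close>, but the scheme
      needs both moments at the starting point of the step, that is at b + c; the discrepancy goes
      into the error.\<close>
    also have "\<dots> \<le> ?S k (b + c) x +
        b * (4 * ?s\<^sup>2 * (?S (Suc k) (b + c) x + real N ^ (2 * Suc k) * (2 * sqrt b * near_error N \<beta>))) +
        ?n * (b * sqrt b * variance_error N \<beta>)"
    proof (rule add_right_mono, rule add_left_mono, rule mult_left_mono[OF _ b(1)])
      have "4 * ?s\<^sup>2 * ?S (Suc k) c x \<le>
          4 * ?s\<^sup>2 * (?S (Suc k) (b + c) x + real N ^ (2 * Suc k) * (2 * sqrt b * near_error N \<beta>))"
        by (intro mult_left_mono smoothed_overlap_near \<beta> b c) auto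
      with sum_dgavg_le[OF \<beta>] show "(\<Sum>xs\<in>words N (2 * k). \<Sum>e\<in>bonds N. (?P c (dgavg N \<beta> (monomial xs) e) x)\<^sup>2)
        \<le> 4 * ?s\<^sup>2 * (?S (Suc k) (b + c) x + real N ^ (2 * Suc k) * (2 * sqrt b * near_error N \<beta>))"
        by (rule order_trans)
    qed
    also have "\<dots> = ?S k (b + c) x + b * (4 * ?s\<^sup>2) * ?S (Suc k) (b + c) x +
      ?n * (b * sqrt b * (variance_error N \<beta> + 2 * (4 * ?s\<^sup>2 * (real N)\<^sup>2) * near_error N \<beta>))"
      by (simp add: power_add power2_eq_square algebra_simps)
    finally show ?thesis unfolding s2 step_error_def by (simp add: mult.assoc)
  qed
  have "?P (a + b) (?S k c) (\<lambda>_. 0) = ?P a (?P b (?S k c)) (\<lambda>_. 0)"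
    using a b by (intro gconv_gconv[symmetric] tame_smoothed_overlap finite_bonds)
  also have "\<dots> \<le> ?P a (\<lambda>x. ?S k (b + c) x + b * (4 * ?s\<^sup>2) * ?S (Suc k) (b + c) x +
      ?n * (b * sqrt b * step_error N \<beta>)) (\<lambda>_. 0)"
    by (intro gconv_mono tame_gconv tame_add tame_mult tame_const tame_smoothed_overlap pt)
  also have "\<dots> = ?P a (?S k (b + c)) (\<lambda>_. 0) + b * (4 * ?s\<^sup>2) * ?P a (?S (Suc k) (b + c)) (\<lambda>_. 0) +
      ?n * (b * sqrt b * step_error N \<beta>)"
    by (simp add: gconv_add gconv_cmult tame_add tame_mult)
  finally have "overlap_moment N \<beta> k (a + b) c \<le>
      (?P a (?S k (b + c)) (\<lambda>_. 0) + b * (4 * ?s\<^sup>2) * ?P a (?S (Suc k) (b + c)) (\<lambda>_. 0) +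
      ?n * (b * sqrt b * step_error N \<beta>)) / ?n"
    unfolding overlap_moment_def using N by (intro divide_right_mono) auto
  also have "\<dots> = overlap_moment N \<beta> k a (b + c) +
      (4 * ?s\<^sup>2 * (real N)\<^sup>2) * b * overlap_moment N \<beta> (Suc k) a (b + c) + b * sqrt b * step_error N \<beta>"
    unfolding overlap_moment_def using N by (simp add: add_divide_distrib power2_eq_square)
  finally show ?thesis unfolding s2 .
qed

text \<open>The solution of \<open>\<partial>\<^sub>t u k = u (k + 1)\<close> with initial value \<open>k! / w ^ (k + 1)\<close> is
  \<open>k! / (w - t) ^ (k + 1)\<close>; by Bernoulli's inequality this is a supersolution of the Euler scheme.\<close>

lemma euler_scheme_bound:
  fixes u :: "nat \<Rightarrow> nat \<Rightarrow> real"
  assumes step: "\<And>j k. j < n \<Longrightarrow> u (Suc j) k \<le> u j k + \<delta> * u j (Suc k) + \<epsilon>"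
    and init: "\<And>k. u 0 k \<le> A * fact k / w ^ (k + 1)"
    and pos: "\<delta> \<ge> 0" "\<epsilon> \<ge> 0" "A \<ge> 0" "w - real n * \<delta> > 0" and j: "j \<le> n"
  shows "u j k \<le> A * fact k / (w - real j * \<delta>) ^ (k + 1) + \<epsilon> * real j * (1 + \<delta>) ^ j"
  using j
proof (induction j arbitrary: k)
  case 0
  then show ?case using init by simp
next
  case (Suc j)
  define z z' where "z = w - real j * \<delta>" and "z' = w - real (Suc j) * \<delta>"
  have "real (Suc j) * \<delta> \<le> real n * \<delta>" using Suc.prems pos by (intro mult_right_mono) auto
  then have z': "z' > 0" using pos by (simp add: z'_def)
  have zz: "z = z' + \<delta>" by (simp add: z_def z'_def algebra_simps)
  then have z: "z > 0" using z' pos by simp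
  have "u (Suc j) k \<le> u j k + \<delta> * u j (Suc k) + \<epsilon>"
    using step Suc.prems by simp
  also have "\<dots> \<le> (A * fact k / z ^ (k + 1) + \<epsilon> * real j * (1 + \<delta>) ^ j) +
      \<delta> * (A * fact (Suc k) / z ^ (Suc k + 1) + \<epsilon> * real j * (1 + \<delta>) ^ j) + \<epsilon>"
    using Suc.IH[of k] Suc.IH[of "Suc k"] Suc.prems pos
    by (intro add_mono mult_left_mono) (auto simp: z_def)
  \<comment> \<open>Since (k+1)! = (k+1) k!, one step multiplies the main term by 1 + (k+1)
    \<delta>/z, which is what Bernoulli's inequality compares with the exact growth factor.\<close>
  also have "\<dots> = A * fact k / z ^ (k + 1) * (1 + real (k + 1) * (\<delta> / z)) +
      (\<epsilon> * real j * (1 + \<delta>) ^ Suc j + \<epsilon>)"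
    using z by (simp add: field_simps)
  also have "\<dots> \<le> A * fact k / z ^ (k + 1) * (z / z') ^ (k + 1) + \<epsilon> * real (Suc j) * (1 + \<delta>) ^ Suc j"
  proof (intro add_mono mult_left_mono)
    have "1 + real (k + 1) * (\<delta> / z) \<le> (1 + \<delta> / z) ^ (k + 1)"
      using z pos by (intro Bernoulli_inequality) (simp add: order_trans[OF _ divide_nonneg_pos])
    also have "\<dots> \<le> (z / z') ^ (k + 1)"
    proof (intro power_mono)
      \<comment> \<open>With z' = z - \<delta> the product (z + \<delta>) z' is a difference of
        squares.\<close>
      have "z * z - \<delta> * \<delta> \<le> z * z" by simp
      then have "(z + \<delta>) * z' \<le> z * z" by (simp add: zz algebra_simps)
      then show "1 + \<delta> / z \<le> z / z'" using z z' by (simp add: field_simps)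
    qed (use z pos in auto)
    finally show "1 + real (k + 1) * (\<delta> / z) \<le> (z / z') ^ (k + 1)" .
    have "1 \<le> (1 + \<delta>) ^ Suc j" using pos by (intro one_le_power) simp
    then have "\<epsilon> * 1 \<le> \<epsilon> * (1 + \<delta>) ^ Suc j" using pos by (intro mult_left_mono) auto
    then show "\<epsilon> * real j * (1 + \<delta>) ^ Suc j + \<epsilon> \<le> \<epsilon> * real (Suc j) * (1 + \<delta>) ^ Suc j"
      by (simp add: algebra_simps)
  qed (use z pos in auto)
  also have "A * fact k / z ^ (k + 1) * (z / z') ^ (k + 1) = A * fact k / z' ^ (k + 1)"
    using z by (simp add: power_divide)
  finally show ?case by (simp add: z'_def)
qed

section \<open>Independent disorder\<close>

text \<open>Termwise comparison of the power series, resting on 2^n n! \<le> (2n)!.\<close>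

lemma cosh_le_exp_half_square: "cosh x \<le> exp (x\<^sup>2 / 2)" for x :: real
proof -
  let ?f = "\<lambda>n. if even n then x ^ n /\<^sub>R fact n else 0"
  have "?f n = 0" if "n \<notin> range (\<lambda>n. 2 * n)" for n
    using that by (auto elim!: evenE)
  moreover have "strict_mono (\<lambda>n :: nat. 2 * n)"
    by (simp add: strict_mono_def)
  ultimately have "(\<lambda>n. ?f (2 * n)) sums cosh x"
    using sums_mono_reindex[of "\<lambda>n. 2 * n" ?f "cosh x"] cosh_converges[of x] by blast
  then have c: "(\<lambda>n. x ^ (2 * n) / fact (2 * n)) sums cosh x"
    by (simp add: divide_inverse mult.commute)
  have e: "(\<lambda>n. (x\<^sup>2 / 2) ^ n / fact n) sums exp (x\<^sup>2 / 2)"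
    using exp_converges[of "x\<^sup>2 / 2"] by (simp only: real_scaleR_def divide_inverse_commute[symmetric])
  have "2 ^ n * fact n \<le> (fact (2 * n) :: real)" for n :: nat
  proof (induction n)
    case (Suc n)
    have "2 ^ Suc n * fact (Suc n) = (2 * real n + 2) * (2 ^ n * fact n)"
      by (simp add: algebra_simps)
    also have "\<dots> \<le> (2 * real n + 2) * ((2 * real n + 1) * fact (2 * n))"
      using Suc by (intro mult_left_mono order_trans[OF Suc]) (auto simp: algebra_simps)
    also have "\<dots> = fact (2 * Suc n)"
      by (simp add: algebra_simps)
    finally show ?case .
  qed simp
  then have "x ^ (2 * n) / fact (2 * n) \<le> (x\<^sup>2 / 2) ^ n / fact n" for n
    by (simp add: power_mult power_divide frac_le)
  then show ?thesis
    by (rule sums_le[OF _ c e])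
qed

text \<open>A single term of the exponential series at |x| is at most exp |x|, which is at most 2
  cosh x.\<close>

lemma power_le_fact_cosh: "(x :: real) ^ (2 * k) \<le> 2 * fact (2 * k) * cosh x"
proof -
  have "(\<lambda>n. \<bar>x\<bar> ^ n / fact n) sums exp \<bar>x\<bar>"
    using exp_converges[of "\<bar>x\<bar>"] by (simp only: real_scaleR_def divide_inverse_commute[symmetric])
  then have "(\<Sum>n\<in>{2 * k}. \<bar>x\<bar> ^ n / fact n) \<le> exp \<bar>x\<bar>"
    by (subst sums_unique[of _ "exp \<bar>x\<bar>"], assumption, intro sum_le_suminf) (auto simp: sums_iff)
  then have "x ^ (2 * k) \<le> fact (2 * k) * exp \<bar>x\<bar>"
    by (simp add: field_simps power_even_abs)
  also have "exp \<bar>x\<bar> \<le> 2 * cosh x"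
    by (cases "x \<ge> 0") (auto simp: cosh_def)
  finally show ?thesis by (simp add: mult.assoc)
qed

lemma card_spin_configs: "card (spin_configs N) = 2 ^ N"
  by (simp add: spin_configs_def card_PiE numeral_2_eq_2)

lemma sum_spin_configs_cosh:
  "(\<Sum>\<epsilon>\<in>spin_configs N. cosh (r * (\<Sum>i\<in>{1..N}. \<epsilon> i))) = 2 ^ N * cosh r ^ N"
proof -
  have ex: "(\<Sum>\<epsilon>\<in>spin_configs N. exp (r * (\<Sum>i\<in>{1..N}. \<epsilon> i))) = (2 * cosh r) ^ N" for r :: real
  proof -
    have "(\<Sum>y\<in>{-1, 1}. exp (r * y)) = 2 * cosh r"
      by (simp add: cosh_field_def)
    then have "(2 * cosh r) ^ N = (\<Prod>i\<in>{1..N}. \<Sum>y\<in>{-1, 1}. exp (r * y))"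
      by simp
    also have "\<dots> = (\<Sum>\<epsilon>\<in>spin_configs N. \<Prod>i\<in>{1..N}. exp (r * \<epsilon> i))"
      unfolding spin_configs_def by (rule prod_sum_PiE) auto
    finally show ?thesis
      by (simp add: sum_distrib_left exp_sum)
  qed
  have "(\<Sum>\<epsilon>\<in>spin_configs N. cosh (r * (\<Sum>i\<in>{1..N}. \<epsilon> i))) =
      ((\<Sum>\<epsilon>\<in>spin_configs N. exp (r * (\<Sum>i\<in>{1..N}. \<epsilon> i))) + (\<Sum>\<epsilon>\<in>spin_configs N. exp (- r * (\<Sum>i\<in>{1..N}. \<epsilon> i)))) / 2"
    by (simp add: cosh_def sum.distrib flip: sum_divide_distrib)
  also have "\<dots> = 2 ^ N * cosh r ^ N"
    unfolding ex by (simp add: power_mult_distrib)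
  finally show ?thesis .
qed

text \<open>Optimal choice of the exponential parameter: \<open>r = sqrt (2 k / N)\<close>.\<close>

lemma rademacher_moment_le:
  assumes N: "N \<ge> 1"
  shows "(\<Sum>\<epsilon>\<in>spin_configs N. (\<Sum>i\<in>{1..N}. \<epsilon> i) ^ (2 * k)) / 2 ^ N \<le> 2 * 6 ^ k * fact k * real N ^ k"
proof (cases "k = 0")
  case True
  then show ?thesis by (simp add: card_spin_configs)
next
  case False
  define r where "r = sqrt (2 * real k / real N)"
  have r: "r\<^sup>2 = 2 * real k / real N" and r_pos: "r > 0" using False N by (simp_all add: r_def)
  \<comment> \<open>The choice of \<open>r\<close> makes N r^2 / 2 equal to k, so the exponential
    moment costs only exp k, at most 3^k.\<close>
  have "cosh r ^ N \<le> exp (r\<^sup>2 / 2) ^ N"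
    by (intro power_mono cosh_le_exp_half_square) simp
  also have "\<dots> = exp (real k)"
    using N by (simp add: r flip: exp_of_nat_mult)
  also have "\<dots> = exp 1 ^ k" by (simp flip: exp_of_nat_mult)
  also have "\<dots> \<le> 3 ^ k" by (intro power_mono exp_le) simp
  finally have ch: "cosh r ^ N \<le> 3 ^ k" .
  have "r ^ (2 * k) * (\<Sum>\<epsilon>\<in>spin_configs N. (\<Sum>i\<in>{1..N}. \<epsilon> i) ^ (2 * k)) =
      (\<Sum>\<epsilon>\<in>spin_configs N. (r * (\<Sum>i\<in>{1..N}. \<epsilon> i)) ^ (2 * k))"
    by (simp only: sum_distrib_left[of "r ^ (2 * k)"] power_mult_distrib)
  also have "\<dots> \<le> (\<Sum>\<epsilon>\<in>spin_configs N. 2 * fact (2 * k) * cosh (r * (\<Sum>i\<in>{1..N}. \<epsilon> i)))"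
    by (intro sum_mono power_le_fact_cosh)
  also have "\<dots> = 2 * fact (2 * k) * (2 ^ N * cosh r ^ N)"
    by (simp only: sum_spin_configs_cosh flip: sum_distrib_left)
  also have "\<dots> \<le> 2 * fact (2 * k) * (2 ^ N * 3 ^ k)"
    using ch by (intro mult_left_mono) auto
  finally have 1: "r ^ (2 * k) * ((\<Sum>\<epsilon>\<in>spin_configs N. (\<Sum>i\<in>{1..N}. \<epsilon> i) ^ (2 * k)) / 2 ^ N)
      \<le> 2 * fact (2 * k) * 3 ^ k"
    by (simp add: field_simps)
  have "real ((2 * k) choose k) = fact (2 * k) / (fact k * fact (2 * k - k))"
    by (rule binomial_fact) simp
  moreover have "2 * k - k = k" by simp
  ultimately have "fact (2 * k) = real ((2 * k) choose k) * (fact k * fact k)"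
    by (simp only:) simp
  \<comment> \<open>Only one of the two factorials is weakened to k^k, to cancel against r^(2k). The
    other stays k!, the form that the initial condition of the hierarchy needs.\<close>
  also have "\<dots> \<le> 2 ^ (2 * k) * (fact k * real k ^ k)"
  proof (intro mult_mono)
    have "real ((2 * k) choose k) \<le> real (\<Sum>i\<le>2 * k. (2 * k) choose i)"
      unfolding of_nat_le_iff by (rule member_le_sum) auto
    then show "real ((2 * k) choose k) \<le> 2 ^ (2 * k)"
      by (simp add: choose_row_sum)
    show "fact k \<le> real k ^ k"
      using fact_le_power[of k] by simp
  qed auto
  finally have "2 * fact (2 * k) * 3 ^ k \<le> 2 * (2 ^ (2 * k) * (fact k * real k ^ k)) * 3 ^ k"
    by simp
  also have "\<dots> = r ^ (2 * k) * (2 * 6 ^ k * fact k * real N ^ k)"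
  proof -
    have six: "(6 :: real) ^ k * 2 ^ k = 2 ^ (2 * k) * 3 ^ k"
      by (simp add: power_mult flip: power_mult_distrib)
    have "r ^ (2 * k) = 2 ^ k * real k ^ k / real N ^ k"
      by (simp add: power_mult r power_divide power_mult_distrib)
    then have "r ^ (2 * k) * (2 * 6 ^ k * fact k * real N ^ k) = 2 * (6 ^ k * 2 ^ k) * fact k * real k ^ k"
      using N by simp
    then show ?thesis unfolding six by simp
  qed
  finally have "2 * fact (2 * k) * 3 ^ k \<le> r ^ (2 * k) * (2 * 6 ^ k * fact k * real N ^ k)" .
  with 1 have "r ^ (2 * k) * ((\<Sum>\<epsilon>\<in>spin_configs N. (\<Sum>i\<in>{1..N}. \<epsilon> i) ^ (2 * k)) / 2 ^ N)
      \<le> r ^ (2 * k) * (2 * 6 ^ k * fact k * real N ^ k)"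
    by (rule order_trans)
  then show ?thesis
    using r_pos by (subst (asm) mult_le_cancel_left_pos) auto
qed

section \<open>Gauge symmetry and the moments for independent disorder\<close>

definition gauge :: "nat \<Rightarrow> (nat \<Rightarrow> real) \<Rightarrow> (nat \<Rightarrow> real) \<Rightarrow> nat \<Rightarrow> real" where
  "gauge N \<epsilon> \<sigma> = (\<lambda>i\<in>{1..N}. \<epsilon> i * \<sigma> i)"

lemma spin_cases: "\<epsilon> \<in> spin_configs N \<Longrightarrow> i \<in> {1..N} \<Longrightarrow> \<epsilon> i = -1 \<or> \<epsilon> i = 1"
  using PiE_mem[of \<epsilon> "{1..N}" "\<lambda>_. {-1, 1}" i] by (simp add: spin_configs_def)

lemma gauge_in:
  assumes "\<epsilon> \<in> spin_configs N" "\<sigma> \<in> spin_configs N"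
  shows "gauge N \<epsilon> \<sigma> \<in> spin_configs N"
proof -
  have "\<epsilon> i * \<sigma> i \<in> {-1, 1}" if "i \<in> {1..N}" for i
    using spin_cases[OF assms(1) that] spin_cases[OF assms(2) that] by auto
  then show ?thesis
    unfolding spin_configs_def gauge_def restrict_PiE_iff by blast
qed

lemma spin_square: "\<epsilon> \<in> spin_configs N \<Longrightarrow> i \<in> {1..N} \<Longrightarrow> \<epsilon> i * \<epsilon> i = 1"
  using spin_cases[of \<epsilon> N i] by auto

lemma gauge_gauge:
  assumes "\<epsilon> \<in> spin_configs N" "\<sigma> \<in> spin_configs N" shows "gauge N \<epsilon> (gauge N \<epsilon> \<sigma>) = \<sigma>"
proof
  fix i
  show "gauge N \<epsilon> (gauge N \<epsilon> \<sigma>) i = \<sigma> i"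
    using spin_square[OF assms(1), of i] assms(2)
    by (cases "i \<in> {1..N}")
       (auto simp: gauge_def spin_configs_def PiE_iff extensional_def simp flip: mult.assoc)
qed

lemma sum_gauge:
  assumes "\<epsilon> \<in> spin_configs N"
  shows "(\<Sum>\<sigma>\<in>spin_configs N. f (gauge N \<epsilon> \<sigma>)) = (\<Sum>\<sigma>\<in>spin_configs N. f \<sigma>)"
  by (rule sum.reindex_bij_witness[of _ "gauge N \<epsilon>" "gauge N \<epsilon>"])
     (auto simp: gauge_in gauge_gauge assms)

lemma monomial_gauge:
  assumes "xs \<in> words N m"
  shows "monomial xs (gauge N \<epsilon> \<sigma>) = monomial xs \<epsilon> * monomial xs \<sigma>"
proof -
  have "set xs \<subseteq> {1..N} \<Longrightarrow> monomial xs (gauge N \<epsilon> \<sigma>) = monomial xs \<epsilon> * monomial xs \<sigma>"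
    by (induction xs) (auto simp: monomial_def gauge_def)
  then show ?thesis using assms by (simp add: words_def)
qed

text \<open>Multiplying each coupling by the product of the two signs at its ends amounts to
  relabelling the spins, which leaves the partition function unchanged and multiplies a monomial by
  its value at \<epsilon>.\<close>

lemma gavg_gauge:
  assumes \<epsilon>: "\<epsilon> \<in> spin_configs N" and xs: "xs \<in> words N m"
  shows "gavg N \<beta> (monomial xs) (\<lambda>e. bond_spin e \<epsilon> * g e) = monomial xs \<epsilon> * gavg N \<beta> (monomial xs) g"
proof -
  have H: "hamiltonian N (\<lambda>e. bond_spin e \<epsilon> * g e) \<sigma> = hamiltonian N g (gauge N \<epsilon> \<sigma>)" for \<sigma>
  proof -
    have "(\<Sum>i\<in>{1..N}. \<Sum>j\<in>{1..N}. bond_spin (i, j) \<epsilon> * g (i, j) * \<sigma> i * \<sigma> j) =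
        (\<Sum>i\<in>{1..N}. \<Sum>j\<in>{1..N}. g (i, j) * gauge N \<epsilon> \<sigma> i * gauge N \<epsilon> \<sigma> j)"
      by (intro sum.cong refl) (simp add: bond_spin_def gauge_def)
    then show ?thesis by (simp only: hamiltonian_def)
  qed
  have "partition_function N \<beta> (\<lambda>e. bond_spin e \<epsilon> * g e) = partition_function N \<beta> g"
    unfolding partition_function_def H by (rule sum_gauge[OF \<epsilon>])
  then have W: "gibbs_weight N \<beta> (\<lambda>e. bond_spin e \<epsilon> * g e) \<sigma> = gibbs_weight N \<beta> g (gauge N \<epsilon> \<sigma>)"
    if "\<sigma> \<in> spin_configs N" for \<sigma>
    using that gauge_in[OF \<epsilon> that] by (simp add: gibbs_weight_def H)
  have "gavg N \<beta> (monomial xs) (\<lambda>e. bond_spin e \<epsilon> * g e) =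
      (\<Sum>\<sigma>\<in>spin_configs N. gibbs_weight N \<beta> g (gauge N \<epsilon> \<sigma>) * monomial xs (gauge N \<epsilon> (gauge N \<epsilon> \<sigma>)))"
    unfolding gavg_def by (intro sum.cong refl) (simp add: W gauge_gauge[OF \<epsilon>])
  also have "\<dots> = (\<Sum>\<sigma>\<in>spin_configs N. gibbs_weight N \<beta> g \<sigma> * monomial xs (gauge N \<epsilon> \<sigma>))"
    by (rule sum_gauge[OF \<epsilon>, of "\<lambda>\<sigma>. gibbs_weight N \<beta> g \<sigma> * monomial xs (gauge N \<epsilon> \<sigma>)"])
  also have "\<dots> = monomial xs \<epsilon> * gavg N \<beta> (monomial xs) g"
    by (simp add: monomial_gauge[OF xs] gavg_def sum_distrib_left ac_simps)
  finally show ?thesis .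
qed

text \<open>Centred at zero the Gaussian noise has a gauge-invariant law, so the averaged monomial
  must be invariant as well. A nonzero common part would break this symmetry, so the argument is
  made at zero common noise only.\<close>

lemma gconv_monomial_gauge:
  assumes \<epsilon>: "\<epsilon> \<in> spin_configs N" and xs: "xs \<in> words N m"
  shows "gconv (bonds N) c (gavg N \<beta> (monomial xs)) (\<lambda>_. 0) =
    monomial xs \<epsilon> * gconv (bonds N) c (gavg N \<beta> (monomial xs)) (\<lambda>_. 0)"
proof -
  let ?f = "gavg N \<beta> (monomial xs)"
  have t: "tame (bonds N) (\<lambda>z. ?f (\<lambda>e. sqrt c * z e))"
    using tame_affine[of "bonds N" ?f "\<lambda>_. 0" "sqrt c"] by simp
  have sign: "bond_spin e \<epsilon> \<in> {-1, 1}" if "e \<in> bonds N" for e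
    using bond_spin_abs[OF \<epsilon> that] by (cases "bond_spin e \<epsilon> \<ge> 0") auto
  have "(\<integral>z. ?f (\<lambda>e. sqrt c * z e) \<partial>gauss (bonds N)) =
      (\<integral>z. ?f (\<lambda>e. sqrt c * (bond_spin e \<epsilon> * z e)) \<partial>gauss (bonds N))"
    by (rule integral_gauss_sign_change[OF t finite_bonds sign, symmetric])
  also have "\<dots> = (\<integral>z. ?f (\<lambda>e. bond_spin e \<epsilon> * (sqrt c * z e)) \<partial>gauss (bonds N))"
    by (simp add: mult.left_commute)
  also have "\<dots> = monomial xs \<epsilon> * (\<integral>z. ?f (\<lambda>e. sqrt c * z e) \<partial>gauss (bonds N))"
    unfolding gavg_gauge[OF \<epsilon> xs] by simp
  finally show ?thesis by (simp add: gconv_def)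
qed

text \<open>Averaging the gauge identity over all \<epsilon> gives I = avg I, and \<open>avg\<close>
  is idempotent, so I^2 is at most the mean of the monomial over uniform signs. Summed over words,
  these means form a moment of a sum of independent signs.\<close>

lemma overlap_moment_independent:
  assumes N: "N \<ge> 1"
  shows "overlap_moment N \<beta> k 0 c \<le> 2 * 6 ^ k * fact k / real N ^ k"
proof -
  let ?S = "spin_configs N"
  define avg where "avg = (\<lambda>xs. (\<Sum>\<epsilon>\<in>?S. monomial xs \<epsilon>) / 2 ^ N)"
  have le: "(gconv (bonds N) c (gavg N \<beta> (monomial xs)) (\<lambda>_. 0))\<^sup>2 \<le> avg xs" if xs: "xs \<in> words N m" for xs m
  proof -
    define I where "I = gconv (bonds N) c (gavg N \<beta> (monomial xs)) (\<lambda>_. 0)"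
    have I: "I = monomial xs \<epsilon> * I" if "\<epsilon> \<in> ?S" for \<epsilon>
      unfolding I_def by (rule gconv_monomial_gauge[OF that xs])
    have "2 ^ N * I = (\<Sum>\<epsilon>\<in>?S. I)"
      by (simp add: card_spin_configs)
    also have "\<dots> = (\<Sum>\<epsilon>\<in>?S. monomial xs \<epsilon> * I)"
      by (intro sum.cong refl I)
    also have "\<dots> = (\<Sum>\<epsilon>\<in>?S. monomial xs \<epsilon>) * I"
      by (simp only: sum_distrib_right)
    finally have "I = avg xs * I"
      by (simp add: avg_def field_simps)
    then have "I\<^sup>2 = (avg xs)\<^sup>2 * I\<^sup>2"
      by (metis power_mult_distrib)
    also have "\<dots> \<le> (avg xs)\<^sup>2 * 1"
      unfolding I_def using gconv_gavg_abs_le[OF xs] by (intro mult_left_mono) (auto simp: abs_square_le_1)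
    \<comment> \<open>The product of the monomial at two configurations is the monomial at their
      pointwise product; for fixed \<epsilon> that product again runs through all configurations,
      hence avg^2 = avg.\<close>
    also have "(avg xs)\<^sup>2 = (\<Sum>\<epsilon>\<in>?S. \<Sum>\<epsilon>'\<in>?S. monomial xs (gauge N \<epsilon> \<epsilon>')) / (2 ^ N * 2 ^ N)"
      by (simp add: avg_def power2_eq_square sum_product monomial_gauge[OF xs])
    also have "\<dots> = avg xs"
      by (simp add: sum_gauge[of _ N "monomial xs"] card_spin_configs avg_def cong: sum.cong)
    finally show ?thesis by (simp add: I_def)
  qed
  have "smoothed_overlap N \<beta> k c (\<lambda>_. 0) \<le> (\<Sum>xs\<in>words N (2 * k). avg xs)"
    unfolding smoothed_overlap_def by (intro sum_mono le)
  \<comment> \<open>The all-ones configuration is inserted as a second replica so that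
    \<open>sum_monomial\<close> applies.\<close>
  also have "\<dots> = (\<Sum>\<epsilon>\<in>?S. \<Sum>xs\<in>words N (2 * k). monomial xs \<epsilon> * monomial xs (\<lambda>_. 1)) / 2 ^ N"
  proof -
    have "monomial xs (\<lambda>_. 1) = 1" for xs by (induction xs) (auto simp: monomial_def)
    then show ?thesis
      unfolding avg_def sum_divide_distrib[symmetric] by (subst sum.swap) simp
  qed
  also have "\<dots> = (\<Sum>\<epsilon>\<in>?S. (\<Sum>i\<in>{1..N}. \<epsilon> i) ^ (2 * k)) / 2 ^ N"
    by (simp add: sum_monomial)
  also have "\<dots> \<le> 2 * 6 ^ k * fact k * real N ^ k"
    by (rule rademacher_moment_le[OF N])
  finally have "overlap_moment N \<beta> k 0 c \<le> 2 * 6 ^ k * fact k * real N ^ k / real N ^ (2 * k)"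
    unfolding overlap_moment_def gconv_zero by (intro divide_right_mono) auto
  also have "\<dots> = 2 * 6 ^ k * fact k / real N ^ k"
  proof -
    have "real N ^ (2 * k) = real N ^ k * real N ^ k" by (simp only: mult_2 power_add)
    moreover have "real N ^ k > 0" using N by simp
    ultimately show ?thesis by (simp only: divide_divide_eq_left[symmetric]) simp
  qed
  finally show ?thesis .
qed

text \<open>The scheme starts at \<rho> = 0 from the independent bound and reaches \<rho> in n equal
  steps; letting n tend to infinity removes the discretisation error.\<close>

lemma overlap_moment_high_temperature:
  assumes \<beta>: "\<beta> \<ge> 0" and \<rho>: "0 \<le> \<rho>" "\<rho> \<le> 1" "\<beta>\<^sup>2 * \<rho> \<le> 1 / 24" and N: "N \<ge> 1" and k: "k \<ge> 1"
  shows "overlap_moment N \<beta> k \<rho> (1 - \<rho>) \<le> (48 * real k) ^ k / real N ^ k"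
proof -
  define n0 where "n0 = real N"
  have n0: "n0 > 0" using N by (simp add: n0_def)
  let ?K = "2 * \<beta>\<^sup>2 * real N" and ?e = "step_error N \<beta>"
  have main: "overlap_moment N \<beta> k \<rho> (1 - \<rho>) \<le> 4 * 12 ^ k * fact k / real N ^ k +
      \<rho> * sqrt (\<rho> / real n) * ?e * exp (?K * \<rho>)" if n: "n \<ge> 1" for n :: nat
  proof -
    define b where "b = \<rho> / real n"
    have b: "0 \<le> b" "b \<le> 1" "real n * b = \<rho>"
      using \<rho> n by (auto simp: b_def field_simps)
    define u where "u = (\<lambda>j k. overlap_moment N \<beta> k (real j * b) (1 - real j * b))"
    define \<delta> where "\<delta> = ?K * b"
    have \<delta>: "\<delta> \<ge> 0" using b by (simp add: \<delta>_def)
    have n\<delta>: "real n * \<delta> = ?K * \<rho>" using b(3) by (simp add: \<delta>_def algebra_simps)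
    have "?K * \<rho> = real N * 2 * (\<beta>\<^sup>2 * \<rho>)" by simp
    \<comment> \<open>This is where 1/24 is spent: the total time n \<delta> is at most N/12, half
      of the blow-up distance N/6.\<close>
    also have "\<dots> \<le> real N * 2 * (1 / 24)" using \<rho> by (intro mult_left_mono) auto
    finally have w: "real N / 6 - real n * \<delta> \<ge> real N / 12"
      unfolding n\<delta> by simp
    have "u n k \<le> (real N / 3) * fact k / (real N / 6 - real n * \<delta>) ^ (k + 1) +
        (b * sqrt b * ?e) * real n * (1 + \<delta>) ^ n"
    proof (rule euler_scheme_bound[of n u \<delta> "b * sqrt b * ?e" "real N / 3" "real N / 6" n k])
      fix j k assume j: "j < n"
      have "real (Suc j) * b \<le> real n * b" using j b by (intro mult_right_mono) auto
      then have c: "1 - real (Suc j) * b \<ge> 0" using b \<rho> by simp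
      show "u (Suc j) k \<le> u j k + \<delta> * u j (Suc k) + b * sqrt b * ?e"
        using overlap_moment_step[OF \<beta> _ b(1,2) c N, of "real j * b" k] b
        by (simp add: u_def \<delta>_def algebra_simps)
    next
      fix k
      \<comment> \<open>The independent bound 2 6^k k! / N^k rewritten in supersolution form, which
        fixes w = N/6 and A = N/3.\<close>
      show "u 0 k \<le> (real N / 3) * fact k / (real N / 6) ^ (k + 1)"
        using overlap_moment_independent[OF N, of \<beta> k 1] n0
        by (simp add: u_def power_divide field_simps flip: n0_def)
    next
      show "real N / 6 - real n * \<delta> > 0" using w N by simp
    qed (use \<delta> b \<beta> step_error_nonneg in auto)
    also have "\<dots> \<le> (real N / 3) * fact k / (real N / 12) ^ (k + 1) + \<rho> * sqrt (\<rho> / real n) * ?e * exp (?K * \<rho>)"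
    proof (intro add_mono divide_left_mono mult_nonneg_nonneg power_mono)
      have "(1 + \<delta>) ^ n \<le> exp \<delta> ^ n" using \<delta> by (intro power_mono) (auto intro: exp_ge_add_one_self)
      also have "\<dots> = exp (?K * \<rho>)" by (simp add: n\<delta> flip: exp_of_nat_mult)
      finally have "(\<rho> * sqrt b * ?e) * (1 + \<delta>) ^ n \<le> (\<rho> * sqrt b * ?e) * exp (?K * \<rho>)"
        using \<rho> b step_error_nonneg[OF \<beta>] by (intro mult_left_mono) auto
      moreover have "(b * sqrt b * ?e) * real n = \<rho> * sqrt b * ?e"
        by (simp add: b(3)[symmetric])
      ultimately show "(b * sqrt b * ?e) * real n * (1 + \<delta>) ^ n \<le> \<rho> * sqrt (\<rho> / real n) * ?e * exp (?K * \<rho>)"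
        by (simp add: b_def)
    qed (use w N in auto)
    also have "(real N / 3) * fact k / (real N / 12) ^ (k + 1) = 4 * 12 ^ k * fact k / real N ^ k"
      using n0 by (simp add: power_divide field_simps flip: n0_def)
    finally show ?thesis using b(3) by (simp add: u_def)
  qed
  have "(\<lambda>n. 4 * 12 ^ k * fact k / real N ^ k + \<rho> * sqrt (\<rho> / real n) * ?e * exp (?K * \<rho>))
      \<longlonglongrightarrow> 4 * 12 ^ k * fact k / real N ^ k + \<rho> * sqrt 0 * ?e * exp (?K * \<rho>)"
    by (intro tendsto_intros lim_const_over_n)
  then have "overlap_moment N \<beta> k \<rho> (1 - \<rho>) \<le> 4 * 12 ^ k * fact k / real N ^ k + \<rho> * sqrt 0 * ?e * exp (?K * \<rho>)"
    by (rule LIMSEQ_le_const) (use main in blast)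
  also have "\<dots> \<le> (48 * real k) ^ k / real N ^ k"
  proof -
    \<comment> \<open>The prefactor 4 is absorbed into 4^k because \<open>k \<ge> 1\<close>;
      together with 12^k this makes 48^k.\<close>
    have "(4 :: real) ^ 1 \<le> 4 ^ k" using k by (intro power_increasing) auto
    moreover have "fact k \<le> real k ^ k" using fact_le_power[of k] by simp
    ultimately have "4 * 12 ^ k * fact k \<le> (4 ^ k * 12 ^ k) * real k ^ k"
      by (intro mult_mono) auto
    also have "\<dots> = (48 * real k) ^ k" by (simp only: power_mult_distrib[symmetric]) simp
    finally show ?thesis by (simp add: divide_right_mono)
  qed
  finally show ?thesis .
qed

section \<open>Chaos\<close>

lemma overlap_moment_sum:
  "overlap_moment N \<beta> k a c = (\<Sum>xs\<in>words N (2 * k).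
     gconv (bonds N) a (\<lambda>x. (gconv (bonds N) c (gavg N \<beta> (monomial xs)) x)\<^sup>2) (\<lambda>_. 0)) / real N ^ (2 * k)"
  unfolding overlap_moment_def smoothed_overlap_def[abs_def]
  by (subst gconv_sum) (auto intro: tame_power)

text \<open>The left side is the square of the mean of f times Y, where Y(g) is the conditional
  expectation of f at a \<rho>-correlated copy of g. As |f| \<le> 1, Jensen bounds it by the mean of
  Y^2. That is the correlation of f at two copies conditionally independent given g, which share
  \<rho> g and hence have correlation \<rho>^2.\<close>

lemma correlated_square_le:
  assumes f: "tame E f" "\<And>x. \<bar>f x\<bar> \<le> 1" and E: "finite E" and \<rho>: "0 \<le> \<rho>" "\<rho> \<le> 1"
  shows "(gconv E \<rho> (\<lambda>x. (gconv E (1 - \<rho>) f x)\<^sup>2) (\<lambda>_. 0))\<^sup>2 \<le>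
    gconv E (\<rho>\<^sup>2) (\<lambda>x. (gconv E (1 - \<rho>\<^sup>2) f x)\<^sup>2) (\<lambda>_. 0)"
proof -
  define Y where "Y = (\<lambda>g. gconv E (1 - \<rho>\<^sup>2) f (\<lambda>e. \<rho> * g e))"
  define Z where "Z = (\<lambda>g. f g * Y g)"
  have tY: "tame E Y"
    unfolding Y_def using tame_affine[OF tame_gconv[OF f(1)], of "1 - \<rho>\<^sup>2" "\<lambda>_. 0" \<rho>] by simp
  have tZ: "tame E Z" unfolding Z_def by (intro tame_mult f tY)
  define m where "m = (\<integral>g. Z g \<partial>gauss E)"
  have "0 \<le> (\<integral>g. (Z g - m)\<^sup>2 \<partial>gauss E)"
    by (intro Bochner_Integration.integral_nonneg) auto
  also have "\<dots> = (\<integral>g. (Z g)\<^sup>2 - 2 * m * Z g + m\<^sup>2 \<partial>gauss E)"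
    by (intro Bochner_Integration.integral_cong) (auto simp: power2_eq_square algebra_simps)
  also have "\<dots> = (\<integral>g. (Z g)\<^sup>2 \<partial>gauss E) - 2 * m * m + m\<^sup>2"
    using integrable_tame[OF tZ] integrable_tame[OF tame_power[OF tZ, of 2]]
    by (simp add: m_def gauss.prob_space)
  finally have "m\<^sup>2 \<le> (\<integral>g. (Z g)\<^sup>2 \<partial>gauss E)"
    by (simp add: power2_eq_square)
  also have "\<dots> \<le> (\<integral>g. (Y g)\<^sup>2 \<partial>gauss E)"
  proof (rule integral_mono[OF integrable_tame[OF tame_power[OF tZ]] integrable_tame[OF tame_power[OF tY]]])
    fix g
    have "(f g)\<^sup>2 \<le> 1" using f(2) by (simp add: abs_square_le_1)
    then show "(Z g)\<^sup>2 \<le> (Y g)\<^sup>2"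
      unfolding Z_def power_mult_distrib by (intro mult_left_le_one_le) auto
  qed
  finally show ?thesis
    unfolding m_def Z_def Y_def integral_correlated_eq_gconv[OF f(1) E \<rho>]
    using \<rho> by (simp add: gconv_def)
qed

text \<open>The squaring inequality holds for each word, and Cauchy-Schwarz over the N^(2k) words
  transfers it to the normalised sum.\<close>

lemma overlap_moment_doubling:
  assumes \<rho>: "0 \<le> \<rho>" "\<rho> \<le> 1" and N: "N \<ge> 1"
  shows "(overlap_moment N \<beta> k \<rho> (1 - \<rho>))\<^sup>2 \<le> overlap_moment N \<beta> k (\<rho>\<^sup>2) (1 - \<rho>\<^sup>2)"
proof -
  define m where "m = (\<lambda>r xs. gconv (bonds N) r (\<lambda>x. (gconv (bonds N) (1 - r) (gavg N \<beta> (monomial xs)) x)\<^sup>2) (\<lambda>_. 0))"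
  let ?W = "words N (2 * k)" and ?n = "real N ^ (2 * k)"
  have "?n > 0" using N by simp
  have "(\<Sum>xs\<in>?W. m \<rho> xs)\<^sup>2 \<le> (\<Sum>xs\<in>?W. (m \<rho> xs)\<^sup>2) * card ?W"
    by (rule sum_squared_le_sum_of_squares)
  also have "\<dots> \<le> (\<Sum>xs\<in>?W. m (\<rho>\<^sup>2) xs) * card ?W"
    unfolding m_def
    by (intro mult_right_mono sum_mono correlated_square_le \<rho> tame_gavg finite_bonds gavg_abs_le)
       (auto simp: monomial_abs)
  finally have "(\<Sum>xs\<in>?W. m \<rho> xs)\<^sup>2 / (?n * ?n) \<le> (\<Sum>xs\<in>?W. m (\<rho>\<^sup>2) xs) * ?n / (?n * ?n)"
    by (intro divide_right_mono) (auto simp: card_words)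
  moreover have "overlap_moment N \<beta> k r (1 - r) = (\<Sum>xs\<in>?W. m r xs) / ?n" for r
    by (simp add: overlap_moment_sum m_def)
  ultimately show ?thesis
    using \<open>?n > 0\<close> N by (simp add: power_divide power2_eq_square[of ?n] split: if_splits)
qed

lemma overlap_moment_le_1: "N \<ge> 1 \<Longrightarrow> overlap_moment N \<beta> k a c \<le> 1"
proof -
  assume N: "N \<ge> 1"
  have "smoothed_overlap N \<beta> k c x \<le> (\<Sum>xs\<in>words N (2 * k). 1)" for x
    unfolding smoothed_overlap_def
    by (intro sum_mono) (use gconv_gavg_abs_le in \<open>simp add: abs_square_le_1\<close>)
  then have "gconv (bonds N) a (smoothed_overlap N \<beta> k c) (\<lambda>_. 0) \<le> gconv (bonds N) a (\<lambda>_. real N ^ (2 * k)) (\<lambda>_. 0)"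
    by (intro gconv_mono tame_smoothed_overlap tame_const) (simp add: card_words)
  then show ?thesis using N by (simp add: overlap_moment_def)
qed

lemma overlap_moment_iterate:
  assumes \<rho>: "0 \<le> \<rho>" "\<rho> \<le> 1" and N: "N \<ge> 1"
  shows "overlap_moment N \<beta> k \<rho> (1 - \<rho>) ^ (2 ^ m) \<le> overlap_moment N \<beta> k (\<rho> ^ (2 ^ m)) (1 - \<rho> ^ (2 ^ m))"
proof (induction m)
  case (Suc m)
  have "overlap_moment N \<beta> k \<rho> (1 - \<rho>) ^ (2 ^ Suc m) = (overlap_moment N \<beta> k \<rho> (1 - \<rho>) ^ (2 ^ m))\<^sup>2"
    by (simp add: mult.commute flip: power_mult)
  also have "\<dots> \<le> (overlap_moment N \<beta> k (\<rho> ^ (2 ^ m)) (1 - \<rho> ^ (2 ^ m)))\<^sup>2"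
    by (intro power_mono Suc.IH zero_le_power overlap_moment_nonneg)
  also have "\<dots> \<le> overlap_moment N \<beta> k ((\<rho> ^ (2 ^ m))\<^sup>2) (1 - (\<rho> ^ (2 ^ m))\<^sup>2)"
    using \<rho> by (intro overlap_moment_doubling N) (auto simp: power_le_one)
  also have "(\<rho> ^ (2 ^ m))\<^sup>2 = \<rho> ^ (2 ^ Suc m)"
    by (simp add: mult.commute flip: power_mult)
  finally show ?case .
qed simp

section \<open>From the replica law to the overlap moments\<close>

lemma pair_gavg_overlap:
  "pair_gavg N \<beta> (\<lambda>\<sigma> \<tau>. overlap N \<sigma> \<tau> ^ m) g g' =
    (\<Sum>xs\<in>words N m. gavg N \<beta> (monomial xs) g * gavg N \<beta> (monomial xs) g') / real N ^ m"
  unfolding pair_gavg_sum_product sum_monomial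
  by (simp only: pair_gavg_alt overlap_def power_divide times_divide_eq_right sum_divide_distrib[symmetric])

lemma nn_integral_pair_gibbs:
  assumes "\<And>\<sigma> \<tau>. u \<sigma> \<tau> \<ge> 0"
  shows "(\<integral>\<^sup>+(\<sigma>, \<tau>). ennreal (u \<sigma> \<tau>) \<partial>measure_pmf (pair_pmf (gibbs N \<beta> g) (gibbs N \<beta> g'))) =
    ennreal (pair_gavg N \<beta> u g g')"
proof -
  let ?M = "pair_pmf (gibbs N \<beta> g) (gibbs N \<beta> g')"
  have fin: "finite (set_pmf ?M)" by (simp add: set_pmf_gibbs)
  have "(\<integral>\<^sup>+(\<sigma>, \<tau>). ennreal (u \<sigma> \<tau>) \<partial>measure_pmf ?M) = (\<integral>\<^sup>+p. ennreal (u (fst p) (snd p)) \<partial>measure_pmf ?M)"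
    by (simp only: case_prod_unfold)
  also have "\<dots> = ennreal (\<integral>p. u (fst p) (snd p) \<partial>measure_pmf ?M)"
    using assms by (intro nn_integral_eq_integral integrable_measure_pmf_finite fin) auto
  also have "(\<integral>p. u (fst p) (snd p) \<partial>measure_pmf ?M) = pair_gavg N \<beta> u g g'"
    unfolding pair_gavg_alt
    by (subst integral_measure_pmf_real[where A="spin_configs N \<times> spin_configs N"])
       (auto simp: set_pmf_gibbs pmf_pair pmf_gibbs mult.commute intro!: sum.cong)
  finally show ?thesis .
qed

text \<open>Disintegrating the law over the disorder and expanding the power into words leaves
  correlations of f at g and at its perturbation, whose correlation coefficient is exp (- t). These
  are the squares supplied by \<open>integral_correlated_eq_gconv\<close>.\<close>

lemma integral_replica_law:
  assumes t: "t \<ge> 0"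
  shows "(\<integral>(\<sigma>1, \<sigma>2). overlap N \<sigma>1 \<sigma>2 ^ (2 * k) \<partial>replica_law N \<beta> t) =
    overlap_moment N \<beta> k (exp (- t)) (1 - exp (- t))"
proof -
  define \<rho> where "\<rho> = exp (- t)"
  have \<rho>: "0 \<le> \<rho>" "\<rho> \<le> 1" using t by (auto simp: \<rho>_def)
  have \<rho>2: "exp (- 2 * t) = \<rho>\<^sup>2" by (simp add: \<rho>_def flip: exp_of_nat_mult)
  let ?G = "gauss (bonds N)" and ?n = "real N ^ (2 * k)"
  let ?K = "\<lambda>(g, g'). measure_pmf (pair_pmf (gibbs N \<beta> g) (gibbs N \<beta> (perturb t g g')))"
  let ?u = "\<lambda>\<sigma> \<tau>. overlap N \<sigma> \<tau> ^ (2 * k)"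
  let ?f = "\<lambda>xs. gavg N \<beta> (monomial xs)"
  define h where "h = (\<lambda>g g'. pair_gavg N \<beta> ?u g (perturb t g g'))"
  have u: "?u \<sigma> \<tau> \<ge> 0" for \<sigma> \<tau> by simp
  have h_nonneg: "h g g' \<ge> 0" for g g'
    unfolding h_def pair_gavg_alt by (intro sum_nonneg mult_nonneg_nonneg gibbs_weight_nonneg u)
  have h_eq: "h g g' = (\<Sum>xs\<in>words N (2 * k). ?f xs g * ?f xs (\<lambda>e. \<rho> * g e + sqrt (1 - \<rho>\<^sup>2) * g' e)) / ?n"
    for g g'
    unfolding h_def pair_gavg_overlap perturb_def \<rho>2 \<rho>_def[symmetric] ..
  have m1: "(\<lambda>p. ?f xs (fst p)) \<in> borel_measurable (?G \<Otimes>\<^sub>M ?G)"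
    and m2: "(\<lambda>p. ?f xs (\<lambda>e. \<rho> * fst p e + sqrt (1 - \<rho>\<^sup>2) * snd p e)) \<in> borel_measurable (?G \<Otimes>\<^sub>M ?G)" for xs
    by (rule tame_compose[OF tame_gavg], measurable)+
  have int: "integrable (?G \<Otimes>\<^sub>M ?G) (\<lambda>(g, g'). ?f xs g * ?f xs (\<lambda>e. \<rho> * g e + sqrt (1 - \<rho>\<^sup>2) * g' e))"
    if xs: "xs \<in> words N m" for xs m
  proof (rule gauss2.P.integrable_const_bound[where B=1])
    have "\<bar>?f xs g\<bar> \<le> 1" for g using xs by (intro gavg_abs_le) (auto simp: monomial_abs)
    then have "norm (?f xs g * ?f xs g') \<le> 1" for g g'
      using mult_le_one[of "\<bar>?f xs g\<bar>" "\<bar>?f xs g'\<bar>"] by (simp add: abs_mult)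
    then show "AE p in ?G \<Otimes>\<^sub>M ?G. norm (case p of (g, g') \<Rightarrow> ?f xs g * ?f xs (\<lambda>e. \<rho> * g e + sqrt (1 - \<rho>\<^sup>2) * g' e)) \<le> 1"
      by (intro AE_I2) (simp add: case_prod_beta)
  qed (use m1 m2 in \<open>simp add: case_prod_beta\<close>)
  \<comment> \<open>The even power is nonnegative, so the integral over the mixture can be split as
    a nonnegative integral and then converted back.\<close>
  have "(\<integral>(\<sigma>1, \<sigma>2). ?u \<sigma>1 \<sigma>2 \<partial>replica_law N \<beta> t) =
      enn2real (\<integral>\<^sup>+(\<sigma>1, \<sigma>2). ennreal (?u \<sigma>1 \<sigma>2) \<partial>replica_law N \<beta> t)"
    by (subst integral_eq_nn_integral)
       (auto simp: measurable_def sets_replica_law case_prod_unfold)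
  also have "(\<integral>\<^sup>+(\<sigma>1, \<sigma>2). ennreal (?u \<sigma>1 \<sigma>2) \<partial>replica_law N \<beta> t) =
      (\<integral>\<^sup>+x. \<integral>\<^sup>+(\<sigma>1, \<sigma>2). ennreal (?u \<sigma>1 \<sigma>2) \<partial>?K x \<partial>(gaussian_couplings N \<Otimes>\<^sub>M gaussian_couplings N))"
    unfolding replica_law_def
    by (rule nn_integral_bind[where B="count_space UNIV"])
       (use measurable_prob_algebraD[OF measurable_replica_kernel] in auto)
  also have "\<dots> = (\<integral>\<^sup>+x. ennreal (case x of (g, g') \<Rightarrow> h g g') \<partial>(?G \<Otimes>\<^sub>M ?G))"
    unfolding gaussian_couplings_eq_gauss
    by (intro nn_integral_cong) (auto simp: nn_integral_pair_gibbs h_def)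
  also have "\<dots> = ennreal (\<integral>x. (case x of (g, g') \<Rightarrow> h g g') \<partial>(?G \<Otimes>\<^sub>M ?G))"
  proof (rule nn_integral_eq_integral)
    show "integrable (?G \<Otimes>\<^sub>M ?G) (\<lambda>(g, g'). h g g')"
      unfolding h_eq case_prod_beta using int[unfolded case_prod_beta]
      by (intro integrable_divide Bochner_Integration.integrable_sum)
  qed (auto simp: h_nonneg)
  also have "enn2real \<dots> = (\<integral>x. (case x of (g, g') \<Rightarrow> h g g') \<partial>(?G \<Otimes>\<^sub>M ?G))"
    by (intro enn2real_ennreal Bochner_Integration.integral_nonneg) (auto simp: h_nonneg)
  also have "\<dots> = (\<Sum>xs\<in>words N (2 * k).
      \<integral>(g, g'). ?f xs g * ?f xs (\<lambda>e. \<rho> * g e + sqrt (1 - \<rho>\<^sup>2) * g' e) \<partial>(?G \<Otimes>\<^sub>M ?G)) / ?n"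
    unfolding h_eq case_prod_beta using int[unfolded case_prod_beta]
    by (simp add: Bochner_Integration.integral_sum)
  also have "\<dots> = (\<Sum>xs\<in>words N (2 * k).
      gconv (bonds N) \<rho> (\<lambda>x. (gconv (bonds N) (1 - \<rho>) (?f xs) x)\<^sup>2) (\<lambda>_. 0)) / ?n"
  proof (intro arg_cong2[where f="(/)"] sum.cong refl)
    fix xs assume xs: "xs \<in> words N (2 * k)"
    have "(\<integral>(g, g'). ?f xs g * ?f xs (\<lambda>e. \<rho> * g e + sqrt (1 - \<rho>\<^sup>2) * g' e) \<partial>(?G \<Otimes>\<^sub>M ?G)) =
        (\<integral>g. \<integral>g'. ?f xs g * ?f xs (\<lambda>e. \<rho> * g e + sqrt (1 - \<rho>\<^sup>2) * g' e) \<partial>?G \<partial>?G)"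
      by (rule gauss2.integral_fst[OF int[OF xs], symmetric])
    also have "\<dots> = (\<integral>g. ?f xs g * gconv (bonds N) (1 - \<rho>\<^sup>2) (?f xs) (\<lambda>e. \<rho> * g e) \<partial>?G)"
      by (simp add: gconv_def)
    also have "\<dots> = gconv (bonds N) \<rho> (\<lambda>x. (gconv (bonds N) (1 - \<rho>) (?f xs) x)\<^sup>2) (\<lambda>_. 0)"
      by (rule integral_correlated_eq_gconv[OF tame_gavg finite_bonds \<rho>])
    finally show "(\<integral>(g, g'). ?f xs g * ?f xs (\<lambda>e. \<rho> * g e + sqrt (1 - \<rho>\<^sup>2) * g' e) \<partial>(?G \<Otimes>\<^sub>M ?G)) =
        gconv (bonds N) \<rho> (\<lambda>x. (gconv (bonds N) (1 - \<rho>) (?f xs) x)\<^sup>2) (\<lambda>_. 0)" .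
  qed
  also have "\<dots> = overlap_moment N \<beta> k \<rho> (1 - \<rho>)"
    by (simp add: overlap_moment_sum)
  finally show ?thesis by (simp add: \<rho>_def)
qed

text \<open>At such times exp (- t) is at most (1 + 5 \<beta>)^(-2), and \<beta> / (1 + 5 \<beta>)
  \<le> 1/5. The 5 is chosen so that 1/25 lies below the admissible 1/24.\<close>

lemma overlap_moment_after_decorrelation:
  assumes \<beta>: "\<beta> \<ge> 0" and t: "t \<ge> 0" "t \<ge> 2 * ln (1 + 5 * \<beta>)" and N: "N \<ge> 1" and k: "k \<ge> 1"
  shows "overlap_moment N \<beta> k (exp (- t)) (1 - exp (- t)) \<le> (48 * real k) ^ k / real N ^ k"
proof (rule overlap_moment_high_temperature[OF \<beta> _ _ _ N k])
  have "exp (- t) \<le> exp (- (2 * ln (1 + 5 * \<beta>)))" using t by simp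
  also have "\<dots> = inverse ((1 + 5 * \<beta>)\<^sup>2)"
    using \<beta> by (simp add: exp_minus exp_double)
  finally have "\<beta>\<^sup>2 * exp (- t) \<le> \<beta>\<^sup>2 * inverse ((1 + 5 * \<beta>)\<^sup>2)"
    by (intro mult_left_mono) auto
  also have "\<dots> = (\<beta> / (1 + 5 * \<beta>))\<^sup>2"
    by (simp add: divide_inverse power_mult_distrib power_inverse)
  also have "\<dots> \<le> (1 / 5)\<^sup>2"
    using \<beta> by (intro power_mono) (auto simp: field_simps)
  finally show "\<beta>\<^sup>2 * exp (- t) \<le> 1 / 24" by (simp add: power2_eq_square)
qed (use t in auto)

text \<open>The least sufficient doubling: by minimality half of the reached time is still below
  \<open>s\<close>, so the overshoot is at most a factor 2.\<close>

lemma exists_dyadic_multiple: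
  fixes s t :: real
  assumes "0 < t" "t \<le> s"
  obtains m :: nat where "s \<le> 2 ^ m * t" "2 ^ m * t \<le> 2 * s"
proof -
  define P where "P = (\<lambda>m :: nat. s \<le> 2 ^ m * t)"
  obtain n :: nat where "s / t < 2 ^ n" using real_arch_pow[of 2 "s / t"] by auto
  then have "P n" using assms by (simp add: P_def field_simps)
  then have "P (LEAST m. P m)" by (rule LeastI)
  moreover have "2 ^ (LEAST m. P m) * t \<le> 2 * s"
  proof (cases "LEAST m. P m")
    case 0
    then show ?thesis using assms by simp
  next
    case (Suc m)
    then have "\<not> P m" using not_less_Least[of m P] by simp
    then show ?thesis using Suc by (simp add: P_def)
  qed
  ultimately show ?thesis using that by (simp add: P_def)
qed

lemma overlap_moment_bound:
  assumes \<beta>: "\<beta> \<ge> 0" and t: "t \<ge> 0" and N: "N \<ge> 1" and k: "k \<ge> 1"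
  shows "overlap_moment N \<beta> k (exp (- t)) (1 - exp (- t)) \<le> (48 * real k) ^ k *
    real N powr (- real k * (if \<beta> = 0 then 1 else min 1 (t / (48 * ln (1 + 48 * \<beta>)))))"
    (is "?m \<le> ?B * real N powr (- real k * ?x)")
proof -
  define s where "s = 2 * ln (1 + 5 * \<beta>)"
  have s: "s \<ge> 0" using \<beta> by (simp add: s_def)
  have B1: "?B \<ge> 1" using k by (intro one_le_power) simp
  have N1: "real N \<ge> 1" using N by simp
  have m0: "?m \<ge> 0" by (rule overlap_moment_nonneg)
  \<comment> \<open>Since N \<ge> 1, a bound with a larger decay exponent y implies the one
    claimed.\<close>
  have less: "?B * real N powr (- real k * y) \<le> ?B * real N powr (- real k * ?x)" if "?x \<le> y" for y
  proof -
    have "real k * ?x \<le> real k * y" using that by (rule mult_left_mono) simp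
    then have "- real k * y \<le> - real k * ?x" by simp
    from powr_mono[OF this N1] show ?thesis by (rule mult_left_mono) simp
  qed
  show ?thesis
  proof (cases "t \<ge> s")
    case True
    have "?m \<le> ?B / real N ^ k"
      using overlap_moment_after_decorrelation[OF \<beta> t _ N k] True by (simp add: s_def)
    also have "\<dots> = ?B * real N powr (- real k * 1)"
      using N by (simp add: powr_minus powr_realpow divide_inverse)
    also have "\<dots> \<le> ?B * real N powr (- real k * ?x)"
      by (rule less) auto
    finally show ?thesis .
  next
    case False
    then have "s > 0" using t by simp
    have "\<beta> \<noteq> 0" using \<open>s > 0\<close> by (auto simp: s_def)
    then have "\<beta> > 0" using \<beta> by simp
    show ?thesis
    proof (cases "t = 0")
      case True
      have "?m \<le> ?B * real N powr (- real k * 0)"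
        using overlap_moment_le_1[OF N, of \<beta> k] B1 N order_trans by (simp add: True) blast
      also have "\<dots> \<le> ?B * real N powr (- real k * ?x)"
        by (rule less) (use \<open>\<beta> \<noteq> 0\<close> in \<open>simp add: True\<close>)
      finally show ?thesis .
    next
      case t0: False
      obtain m :: nat where m: "s \<le> 2 ^ m * t" "2 ^ m * t \<le> 2 * s"
        using exists_dyadic_multiple[of t s] t t0 False by auto
      have ex: "exp (- t) ^ (2 ^ m) = exp (- (2 ^ m * t))"
        by (simp flip: exp_of_nat_mult)
      define p where "p = (2 :: real) ^ m"
      have p: "p \<ge> 1" by (simp add: p_def)
      have "?m ^ (2 ^ m) \<le> overlap_moment N \<beta> k (exp (- (2 ^ m * t))) (1 - exp (- (2 ^ m * t)))"
        using overlap_moment_iterate[of "exp (- t)" N \<beta> k m] t N by (simp add: ex)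
      also have "\<dots> \<le> ?B / real N ^ k"
        using overlap_moment_after_decorrelation[OF \<beta> _ _ N k, of "2 ^ m * t"] m t by (simp add: s_def)
      also have "\<dots> = ?B * real N powr (- real k)"
        using N by (simp add: powr_minus powr_realpow divide_inverse)
      \<comment> \<open>The prefactor is inflated to its 2^m-th power, allowed as it is at least 1,
        so that extracting the root returns exactly \<open>?B\<close>. The root divides the decay
        exponent by p = 2^m.\<close>
      also have "\<dots> \<le> ?B ^ (2 ^ m) * (real N powr (- real k * (1 / p))) ^ (2 ^ m)"
      proof (intro mult_mono)
        show "?B \<le> ?B ^ (2 ^ m)" using B1 by (intro self_le_power) auto
        show "real N powr (- real k) \<le> (real N powr (- real k * (1 / p))) ^ (2 ^ m)"
          using p N by (simp add: powr_power p_def)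
      qed (use B1 in auto)
      finally have "?m ^ (2 ^ m) \<le> (?B * real N powr (- real k * (1 / p))) ^ (2 ^ m)"
        by (simp only: power_mult_distrib)
      then have "?m \<le> ?B * real N powr (- real k * (1 / p))"
        using m0 by (subst (asm) power_mono_iff) auto
      also have "\<dots> \<le> ?B * real N powr (- real k * ?x)"
      proof (rule less)
        have ln: "0 < ln (1 + 5 * \<beta>)" "ln (1 + 5 * \<beta>) \<le> ln (1 + 48 * \<beta>)"
          using \<open>\<beta> > 0\<close> by auto
        \<comment> \<open>The dyadic time is at most 2 s = 4 ln (1 + 5 \<beta>), so 1/p is at least
          of the order of t / ln (1 + 5 \<beta>), and 48 is ample on the time scale.\<close>
        have "p * t \<le> 48 * ln (1 + 48 * \<beta>)"
          using m(2) ln by (simp add: p_def s_def)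
        then have "t / (48 * ln (1 + 48 * \<beta>)) \<le> 1 / p"
          using p ln by (simp add: field_simps)
        then show "?x \<le> 1 / p" using \<open>\<beta> > 0\<close> by simp
      qed
      finally show ?thesis .
    qed
  qed
qed

theorem theorem1p4:
  shows "\<exists>C::real. C > 0 \<and>
    (\<forall>(N::nat) (\<beta>::real) (t::real) (k::nat).
       N \<ge> 1 \<longrightarrow> \<beta> \<ge> 0 \<longrightarrow> t \<ge> 0 \<longrightarrow> k \<ge> 1 \<longrightarrow>
       (\<integral>(\<sigma>1, \<sigma>2). overlap N \<sigma>1 \<sigma>2 ^ (2 * k) \<partial>replica_law N \<beta> t)
         \<le> (C * real k) ^ k *
            real N powr (- real k * (if \<beta> = 0 then 1 else min 1 (t / (C * ln (1 + C * \<beta>))))))"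
\<comment> \<open>The value 48 = 4 * 12 stems from the moment prefactor; the same number then serves
  in the time scale.\<close>
proof (intro exI[of _ 48] conjI allI impI)
  fix N k :: nat and \<beta> t :: real
  assume "N \<ge> 1" "\<beta> \<ge> 0" "t \<ge> 0" "k \<ge> 1"
  then show "(\<integral>(\<sigma>1, \<sigma>2). overlap N \<sigma>1 \<sigma>2 ^ (2 * k) \<partial>replica_law N \<beta> t)
      \<le> (48 * real k) ^ k *
        real N powr (- real k * (if \<beta> = 0 then 1 else min 1 (t / (48 * ln (1 + 48 * \<beta>)))))"
    unfolding integral_replica_law[OF \<open>t \<ge> 0\<close>] by (intro overlap_moment_bound)
qed simp

end
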